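(* Let $V$ be a finite dimensional real vector space, $B\subseteq V$ a compact convex polyhedral $0$-neighborhood with associated asymmetric polyhedral norm $\nu$. The sets $U(L,\varepsilon,q)$, for $\varepsilon>0$, $q\in V$ and $L\in\Sigma\cup\{K\}$, form a basis for the topology imposed on $\bigsqcup\{V_L\mid L\in\Sigma\cup\{K\}\}$ by the bijection $\Phi$ from the bordification $\widehat V$.
   Context: $V$ is a finite dimensional real vector space with dual $V^\vee$, endowed with a Euclidean norm $\|\cdot\|$; $B_\varepsilon(0)=\{v\in V\mid\|v\|<\varepsilon\}$, and $0$ is the base point. $B\subseteq V$ is a compact convex polyhedral neighborhood of $0$ with codimension-1 faces $A_0,\dots,A_m$, and $K=\{0,\dots,m\}$. For each $j\in K$, $\xi_j\in V^\vee$ is the unique linear functional with $A_j=\{v\in B\mid \xi_j(v)=1\}$; thus $B=\{u\in V\mid \xi_j(u)\le 1\text{ for all }j\in K\}$, and the asymmetric norm with unit ball $B$ is $\nu(u)=\max\{\xi_0(u),\dots,\xi_m(u)\}$. Put $\delta(u,v)=\nu(u-v)$. A nonempty subset $L\subseteq K$ is a dual face if there is $v\in V$ with $\nu(v)=1$ and $L=\{k\in K\mid \xi_k(v)=1\}$; $\Sigma$ is the set of all dual faces. For nonempty $L\subseteq K$: $\nu_L(u)=\max\{\xi_\ell(u)\mid \ell\in L\}$ and $H_L=\{u\in V\mid \xi_k(u)=\xi_\ell(u)\text{ for all }k,\ell\in L\}$. For $L\in\Sigma$, $H_L^+=\{v\in H_L\mid \xi_\ell(v)>\xi_k(v)\text{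 for all }\ell\in L\text{ and }k\in K\setminus L\}$. Put $V_K=V$ and $V_L=V/H_L$ for $L\in\Sigma$. For $L\in\Sigma$, $\varepsilon>0$, $q\in V$ put $D=q+B_\varepsilon(0)+H_L^+\subseteq V=V_K$ and $$U(L,\varepsilon,q)=D\sqcup\bigsqcup\{(D+H_{L'})/H_{L'}\mid L'\in\Sigma,\ L'\supseteq L\}\subseteq\bigsqcup\{V_{L'}\mid L'\in\Sigma\cup\{K\}\},$$ where $(D+H_{L'})/H_{L'}\subseteq V_{L'}$; and $U(K,\varepsilon,q)=q+B_\varepsilon(0)\subseteq V=V_K$. The bordification $\widehat V$ is the closure of $\{u\mapsto\delta(p,u)-\delta(p,0)\mid p\in V\}$ in the space of continuous functions $f:V\to\mathbb R$ with $f(0)=0$, in the topology of uniform convergence on bounded sets. Its elements are exactly the functions $v\mapsto\nu(p-v)-\nu(p)$ with $p\in V$ and $v\mapsto\nu_L(p-v)-\nu_L(p)$ with $p\in V$, $L\in\Sigma$. The map $\Phi:\widehat V\to\bigsqcup\{V_L\mid L\in\Sigma\cup\{K\}\}$ sending the former to $p\in V_K$ and the latter to $p+H_L\in V_L$ is a bijection; the topology imposed by $\Phi$ is the one making $\Phi$ a homeomorphism. *)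

theory Defs
  imports "HOL-Analysis.Analysis" "HOL-Library.Set_Algebras"
begin

text \<open>
  The index set of the facets is \<open>K :: nat set\<close>; the functionals are a family
  \<open>\<xi> :: nat \<Rightarrow> 'a \<Rightarrow> real\<close>, used only at indices in \<open>K\<close>.
  Sums of sets and cosets are those of \<open>Set_Algebras\<close>: \<open>S + T\<close> is the
  Minkowski sum and \<open>p +o H\<close> is the coset of \<open>p\<close>.
\<close>

definition nu :: "(nat \<Rightarrow> 'a \<Rightarrow> real) \<Rightarrow> nat set \<Rightarrow> 'a \<Rightarrow> real" where
  "nu \<xi> L u = Max ((\<lambda>l. \<xi> l u) ` L)"

definition delta :: "(nat \<Rightarrow> 'a::minus \<Rightarrow> real) \<Rightarrow> nat set \<Rightarrow> 'a \<Rightarrow> 'a \<Rightarrow> real" where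
  "delta \<xi> K u v = nu \<xi> K (u - v)"

definition dual_faces :: "(nat \<Rightarrow> 'a \<Rightarrow> real) \<Rightarrow> nat set \<Rightarrow> nat set set" where
  "dual_faces \<xi> K =
     {L. L \<noteq> {} \<and> L \<subseteq> K \<and> (\<exists>v. nu \<xi> K v = 1 \<and> L = {k \<in> K. \<xi> k v = 1})}"

definition H :: "(nat \<Rightarrow> 'a \<Rightarrow> real) \<Rightarrow> nat set \<Rightarrow> 'a set" where
  "H \<xi> L = {u. \<forall>k\<in>L. \<forall>l\<in>L. \<xi> k u = \<xi> l u}"

definition Hplus :: "(nat \<Rightarrow> 'a \<Rightarrow> real) \<Rightarrow> nat set \<Rightarrow> nat set \<Rightarrow> 'a set" where
  "Hplus \<xi> K L = {v \<in> H \<xi> L. \<forall>l\<in>L. \<forall>k\<in>K - L. \<xi> l v > \<xi> k v}"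

text \<open>
  The disjoint union of the strata: \<open>Inl p\<close> is the point \<open>p\<close> of \<open>V\<^sub>K = V\<close>, and
  \<open>Inr (L, C)\<close> with \<open>L\<close> a dual face is the point \<open>C\<close> (a coset of \<open>H \<xi> L\<close>) of
  \<open>V\<^sub>L = V / H\<^sub>L\<close>.
\<close>

definition strata :: "(nat \<Rightarrow> 'a::plus \<Rightarrow> real) \<Rightarrow> nat set \<Rightarrow> ('a + nat set \<times> 'a set) set" where
  "strata \<xi> K =
     range Inl \<union> Inr ` (SIGMA L : dual_faces \<xi> K. {p +o H \<xi> L | p. True})"

definition U_set ::
  "(nat \<Rightarrow> 'a::real_normed_vector \<Rightarrow> real) \<Rightarrow> nat set \<Rightarrow> nat set \<Rightarrow> real \<Rightarrow> 'a
     \<Rightarrow> ('a + nat set \<times> 'a set) set" where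
  "U_set \<xi> K L \<epsilon> q =
     (if L = K then Inl ` (q +o ball 0 \<epsilon>)
      else let D = q +o (ball 0 \<epsilon> + Hplus \<xi> K L) in
        Inl ` D \<union>
        Inr ` (SIGMA L' : {L' \<in> dual_faces \<xi> K. L \<subseteq> L'}. {p +o H \<xi> L' | p. p \<in> D + H \<xi> L'}))"

definition pointed_continuous :: "('a::real_normed_vector \<Rightarrow> real) set" where
  "pointed_continuous = {f. continuous_on UNIV f \<and> f 0 = 0}"

text \<open>The topology of uniform convergence on bounded sets, given by its neighbourhood bases.\<close>

definition bounded_uniform_topology :: "('a::real_normed_vector \<Rightarrow> real) topology" where
  "bounded_uniform_topology = topology (\<lambda>W. W \<subseteq> pointed_continuous \<and>
     (\<forall>f\<in>W. \<exists>S e. bounded S \<and> e > 0 \<and>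
        {g \<in> pointed_continuous. \<forall>x\<in>S. \<bar>g x - f x\<bar> < e} \<subseteq> W))"

lemma openin_bounded_uniform_topology:
  "openin bounded_uniform_topology W \<longleftrightarrow>
     W \<subseteq> (pointed_continuous :: ('a::real_normed_vector \<Rightarrow> real) set) \<and>
     (\<forall>f\<in>W. \<exists>S e. bounded S \<and> e > 0 \<and>
        {g \<in> pointed_continuous. \<forall>x\<in>S. \<bar>g x - f x\<bar> < e} \<subseteq> W)"
proof -
  let ?N = "\<lambda>(f :: 'a \<Rightarrow> real) S e. {g \<in> pointed_continuous. \<forall>x\<in>S. \<bar>g x - f x\<bar> < e}"
  let ?P = "\<lambda>W. W \<subseteq> pointed_continuous \<and>
     (\<forall>f\<in>W. \<exists>S e. bounded S \<and> e > 0 \<and> ?N f S e \<subseteq> W)"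
  have "istopology ?P"
    unfolding istopology_def
  proof (intro conjI allI impI)
    fix W1 W2 :: "('a \<Rightarrow> real) set"
    assume W: "?P W1" "?P W2"
    then show "W1 \<inter> W2 \<subseteq> pointed_continuous" by blast
    show "\<forall>f\<in>W1 \<inter> W2. \<exists>S e. bounded S \<and> e > 0 \<and> ?N f S e \<subseteq> W1 \<inter> W2"
    proof
      fix f assume "f \<in> W1 \<inter> W2"
      then have f: "f \<in> W1" "f \<in> W2" by simp_all
      obtain S1 e1 where 1: "bounded S1" "e1 > 0" "?N f S1 e1 \<subseteq> W1"
        using bspec[OF conjunct2[OF W(1)] f(1)] by (elim exE conjE)
      obtain S2 e2 where 2: "bounded S2" "e2 > 0" "?N f S2 e2 \<subseteq> W2"
        using bspec[OF conjunct2[OF W(2)] f(2)] by (elim exE conjE)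
      have "?N f (S1 \<union> S2) (min e1 e2) \<subseteq> ?N f S1 e1 \<inter> ?N f S2 e2" by auto
      also have "\<dots> \<subseteq> W1 \<inter> W2" using 1(3) 2(3) by (rule Int_mono)
      finally have "?N f (S1 \<union> S2) (min e1 e2) \<subseteq> W1 \<inter> W2" .
      moreover have "bounded (S1 \<union> S2)" "min e1 e2 > 0" using 1 2 by simp_all
      ultimately show "\<exists>S e. bounded S \<and> e > 0 \<and> ?N f S e \<subseteq> W1 \<inter> W2"
        by (intro exI[of _ "S1 \<union> S2"] exI[of _ "min e1 e2"] conjI)
    qed
  next
    fix \<W> :: "('a \<Rightarrow> real) set set"
    assume "\<forall>W\<in>\<W>. ?P W"
    then show "\<Union>\<W> \<subseteq> pointed_continuous" by blast
    show "\<forall>f\<in>\<Union>\<W>. \<exists>S e. bounded S \<and> e > 0 \<and> ?N f S e \<subseteq> \<Union>\<W>"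
    proof
      fix f assume "f \<in> \<Union>\<W>"
      then obtain W where W: "W \<in> \<W>" "f \<in> W" by blast
      have PW: "?P W" using \<open>\<forall>W\<in>\<W>. ?P W\<close> W(1) by (rule bspec)
      then obtain S e where "bounded S" "e > 0" "?N f S e \<subseteq> W"
        using bspec[OF conjunct2[OF PW] W(2)] by (elim exE conjE)
      moreover from this(3) have "?N f S e \<subseteq> \<Union>\<W>"
        by (rule subset_trans) (rule Union_upper[OF W(1)])
      ultimately show "\<exists>S e. bounded S \<and> e > 0 \<and> ?N f S e \<subseteq> \<Union>\<W>"
        by (intro exI[of _ S] exI[of _ e] conjI)
    qed
  qed
  then show ?thesis
    by (simp add: bounded_uniform_topology_def topology_inverse')
qed

definition bordification ::
  "(nat \<Rightarrow> 'a::real_normed_vector \<Rightarrow> real) \<Rightarrow> nat set \<Rightarrow> ('a \<Rightarrow> real) topology" where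
  "bordification \<xi> K = subtopology bounded_uniform_topology
     (bounded_uniform_topology closure_of
        {\<lambda>u. delta \<xi> K p u - delta \<xi> K p 0 | p. True})"

definition Phi ::
  "(nat \<Rightarrow> 'a::real_normed_vector \<Rightarrow> real) \<Rightarrow> nat set \<Rightarrow> ('a \<Rightarrow> real) \<Rightarrow> 'a + nat set \<times> 'a set" where
  "Phi \<xi> K f = (THE y.
     (\<exists>p. f = (\<lambda>v. nu \<xi> K (p - v) - nu \<xi> K p) \<and> y = Inl p) \<or>
     (\<exists>L\<in>dual_faces \<xi> K. \<exists>p. f = (\<lambda>v. nu \<xi> L (p - v) - nu \<xi> L p) \<and> y = Inr (L, p +o H \<xi> L)))"

text \<open>
  There is at most one such topology, since \<open>homeomorphic_map\<close> determines the open sets of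
  its target; there is one precisely if \<open>Phi \<xi> K\<close> maps the bordification bijectively
  onto the strata.
\<close>

definition strata_topology ::
  "(nat \<Rightarrow> 'a::real_normed_vector \<Rightarrow> real) \<Rightarrow> nat set \<Rightarrow> ('a + nat set \<times> 'a set) topology" where
  "strata_topology \<xi> K =
     (THE T. topspace T = strata \<xi> K \<and> homeomorphic_map (bordification \<xi> K) T (Phi \<xi> K))"

end

theory Submission
  imports Defs
begin

text \<open>
  All strata are treated alike: since \<open>H\<^sub>K = 0\<close> and \<open>H\<^sub>K\<^sup>+ = 0\<close>, the open stratum is the case
  \<open>L = K\<close> of the boundary strata, and \<open>\<Sigma> \<union> {K}\<close> consists of the nonempty \<open>L \<subseteq> K\<close> with
  \<open>H\<^sub>L\<^sup>+ \<noteq> \<emptyset>\<close>. Write \<open>h\<^sub>L\<^sub>,\<^sub>p\<close> for \<open>v \<mapsto> \<nu>\<^sub>L (p - v) - \<nu>\<^sub>L p\<close>.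

  Two estimates carry the proof. First, every facet has a point at which its functional is \<open>1\<close>
  and all others are smaller; far out on the opposite rays a function close to \<open>h\<^sub>L\<^sub>,\<^sub>q\<close> reveals
  the numbers \<open>\<xi>\<^sub>k p - \<nu> p\<close>, which forces its index into \<open>U (L, \<epsilon>, q)\<close>. This gives both the
  injectivity of \<open>\<Phi>\<close> and the openness of \<open>U (L, \<epsilon>, q)\<close>. Second, after a long shift of \<open>p\<close>
  in the direction of \<open>H\<^sub>L\<^sup>+\<close>, on a given bounded set only the functionals in \<open>L\<close> contribute
  to the maximum, so \<open>U (L, \<epsilon>, p + w)\<close> lies in a prescribed neighbourhood of \<open>h\<^sub>L\<^sub>,\<^sub>p\<close>. That the
  closure contains no further functions follows by compactness.
\<close>

section \<open>Horofunctions, points of the strata, and tubes\<close>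

definition horo :: "(nat \<Rightarrow> 'a::real_normed_vector \<Rightarrow> real) \<Rightarrow> nat set \<Rightarrow> 'a \<Rightarrow> 'a \<Rightarrow> real" where
  "horo \<xi> L p v = nu \<xi> L (p - v) - nu \<xi> L p"

text \<open>This encoding lets \<open>L\<close> run over all strata at once, the coset of the zero
  subspace \<open>H \<xi> K\<close> being written as \<open>Inl p\<close>.\<close>

definition point ::
  "(nat \<Rightarrow> 'a::real_normed_vector \<Rightarrow> real) \<Rightarrow> nat set \<Rightarrow> nat set \<Rightarrow> 'a \<Rightarrow> 'a + nat set \<times> 'a set" where
  "point \<xi> K L p = (if L = K then Inl p else Inr (L, p +o H \<xi> L))"

text \<open>The set \<open>D\<close> in \<open>U_set\<close>. For \<open>L = K\<close> it becomes
  the ball about \<open>q\<close>, because the cone is then \<open>{0}\<close>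
  (\<open>Hplus_K\<close>).\<close>

definition tube ::
  "(nat \<Rightarrow> 'a::real_normed_vector \<Rightarrow> real) \<Rightarrow> nat set \<Rightarrow> nat set \<Rightarrow> real \<Rightarrow> 'a \<Rightarrow> 'a set" where
  "tube \<xi> K L \<epsilon> q = q +o (ball 0 \<epsilon> + Hplus \<xi> K L)"

lemma mem_tube:
  "x \<in> tube \<xi> K L \<epsilon> q \<longleftrightarrow> (\<exists>b u. norm b < \<epsilon> \<and> u \<in> Hplus \<xi> K L \<and> x = q + b + u)"
proof
  assume "x \<in> tube \<xi> K L \<epsilon> q"
  then show "\<exists>b u. norm b < \<epsilon> \<and> u \<in> Hplus \<xi> K L \<and> x = q + b + u"
    unfolding tube_def elt_set_plus_def set_plus_def by (force simp: add.assoc)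
next
  assume "\<exists>b u. norm b < \<epsilon> \<and> u \<in> Hplus \<xi> K L \<and> x = q + b + u"
  then obtain b u where "norm b < \<epsilon>" "u \<in> Hplus \<xi> K L" "x = q + (b + u)"
    by (auto simp: add.assoc)
  then show "x \<in> tube \<xi> K L \<epsilon> q"
    unfolding tube_def by (auto intro!: set_plus_intro2 set_plus_intro)
qed

section \<open>Subsequences and minima over finite families\<close>

lemma ereal_finite_subseq:
  fixes X :: "'i \<Rightarrow> nat \<Rightarrow> ereal"
  assumes "finite I"
  shows "\<exists>r l. strict_mono r \<and> (\<forall>i\<in>I. (\<lambda>n. X i (r n)) \<longlonglongrightarrow> l i)"
  using assms
proof induction
  case empty
  then show ?case using strict_mono_id by auto
next
  case (insert i I)
  then obtain r l where r: "strict_mono r" "\<forall>i\<in>I. (\<lambda>n. X i (r n)) \<longlonglongrightarrow> l i" by blast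
  obtain l' r' where r': "strict_mono r'" "((\<lambda>n. X i (r n)) \<circ> r') \<longlonglongrightarrow> l'"
    using compact_complete_linorder by blast
  have "(\<lambda>n. X j (r (r' n))) \<longlonglongrightarrow> (l(i := l')) j" if "j \<in> insert i I" for j
  proof (cases "j = i")
    case True
    then show ?thesis using r'(2) by (simp add: o_def)
  next
    case False
    then have "(\<lambda>n. X j (r n)) \<longlonglongrightarrow> l j" using that r(2) by blast
    from LIMSEQ_subseq_LIMSEQ[OF this r'(1)] False show ?thesis by (simp add: o_def)
  qed
  moreover have "strict_mono (r \<circ> r')" using r(1) r'(1) by (rule strict_mono_o)
  ultimately show ?case by (intro exI[of _ "r \<circ> r'"] exI[of _ "l(i := l')"]) (simp add: o_def)
qed

lemma finite_gap:
  fixes P :: "real set"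
  assumes "finite P" "\<And>x. x \<in> P \<Longrightarrow> x > 0"
  shows "\<exists>d>0. \<forall>x\<in>P. d \<le> x"
  \<comment> \<open>Inserting 1 makes the minimum exist also for empty \<open>P\<close>.\<close>
  using assms by (intro exI[of _ "Min (insert 1 P)"]) (simp add: Min_gr_iff)

section \<open>Uniform convergence on bounded sets\<close>

lemma topspace_bounded_uniform_topology:
  "topspace (bounded_uniform_topology :: ('a::real_normed_vector \<Rightarrow> real) topology) = pointed_continuous"
proof
  show "topspace bounded_uniform_topology \<subseteq> (pointed_continuous :: ('a \<Rightarrow> real) set)"
    using openin_topspace[of "bounded_uniform_topology :: ('a \<Rightarrow> real) topology"]
    unfolding openin_bounded_uniform_topology by blast
  have "openin bounded_uniform_topology (pointed_continuous :: ('a \<Rightarrow> real) set)"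
    unfolding openin_bounded_uniform_topology
    by (intro conjI ballI exI[of _ "{}"] exI[of _ "1 :: real"]) auto
  then show "(pointed_continuous :: ('a \<Rightarrow> real) set) \<subseteq> topspace bounded_uniform_topology"
    by (rule openin_subset)
qed

text \<open>The set of all \<open>g\<close> with \<open>\<bar>g x - f x\<bar> < e\<close> on
  \<open>S\<close> need not be open, since the supremum over \<open>S\<close> may equal
  \<open>e\<close>. Demanding a uniform bound \<open>d < e\<close> leaves a margin
  \<open>e - d\<close>, half of which can be spent on a perturbation.\<close>

lemma bounded_uniform_nbhd:
  fixes f :: "'a::real_normed_vector \<Rightarrow> real"
  assumes "f \<in> pointed_continuous" "bounded S" "e > 0"
  shows "\<exists>W. openin bounded_uniform_topology W \<and> f \<in> W \<and> (\<forall>g\<in>W. \<forall>x\<in>S. \<bar>g x - f x\<bar> < e)"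
proof -
  define W where "W = {g \<in> pointed_continuous. \<exists>d<e. \<forall>x\<in>S. \<bar>g x - f x\<bar> \<le> d}"
  have "openin bounded_uniform_topology W"
    unfolding openin_bounded_uniform_topology
  proof (intro conjI ballI)
    show "W \<subseteq> pointed_continuous" unfolding W_def by blast
    fix g assume "g \<in> W"
    then obtain d where d: "d < e" "\<forall>x\<in>S. \<bar>g x - f x\<bar> \<le> d" unfolding W_def by blast
    have "h \<in> W" if h: "h \<in> pointed_continuous" "\<forall>x\<in>S. \<bar>h x - g x\<bar> < (e - d) / 2" for h
    proof -
      have "\<bar>h x - f x\<bar> \<le> (e + d) / 2" if "x \<in> S" for x
      proof -
        have "\<bar>h x - g x\<bar> < (e - d) / 2" "\<bar>g x - f x\<bar> \<le> d" using h d that by auto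
        then show ?thesis by (auto simp: field_simps abs_if split: if_splits)
      qed
      moreover have "(e + d) / 2 < e" using d by simp
      ultimately show ?thesis using h unfolding W_def by blast
    qed
    then show "\<exists>S e. bounded S \<and> 0 < e \<and> {h \<in> pointed_continuous. \<forall>x\<in>S. \<bar>h x - g x\<bar> < e} \<subseteq> W"
      using assms(2) d(1) by (intro exI[of _ S] exI[of _ "(e - d) / 2"]) auto
  qed
  moreover have "f \<in> W" using assms unfolding W_def by (auto intro!: exI[of _ 0])
  moreover have "\<forall>g\<in>W. \<forall>x\<in>S. \<bar>g x - f x\<bar> < e" unfolding W_def by fastforce
  ultimately show ?thesis by blast
qed

lemma openin_subtopology_bounded_uniform:
  fixes X :: "('a::real_normed_vector \<Rightarrow> real) set"
  assumes "X \<subseteq> pointed_continuous"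
  shows "openin (subtopology bounded_uniform_topology X) V \<longleftrightarrow>
    V \<subseteq> X \<and> (\<forall>f\<in>V. \<exists>S e. bounded S \<and> e > 0 \<and> {g \<in> X. \<forall>x\<in>S. \<bar>g x - f x\<bar> < e} \<subseteq> V)"
proof
  assume "openin (subtopology bounded_uniform_topology X) V"
  then obtain W where W: "openin bounded_uniform_topology W" "V = W \<inter> X"
    by (auto simp: openin_subtopology)
  have "\<exists>S e. bounded S \<and> e > 0 \<and> {g \<in> X. \<forall>x\<in>S. \<bar>g x - f x\<bar> < e} \<subseteq> V" if "f \<in> V" for f
  proof -
    have "f \<in> W" using that W by blast
    then obtain S e where "bounded S" "e > 0"
      and sub: "{g \<in> pointed_continuous. \<forall>x\<in>S. \<bar>g x - f x\<bar> < e} \<subseteq> W"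
      using W(1)[unfolded openin_bounded_uniform_topology] by auto
    moreover have "{g \<in> X. \<forall>x\<in>S. \<bar>g x - f x\<bar> < e} \<subseteq> V" using sub W(2) assms by auto
    ultimately show ?thesis by (intro exI[of _ S] exI[of _ e]) simp
  qed
  then show "V \<subseteq> X \<and> (\<forall>f\<in>V. \<exists>S e. bounded S \<and> e > 0 \<and> {g \<in> X. \<forall>x\<in>S. \<bar>g x - f x\<bar> < e} \<subseteq> V)"
    using W by auto
next
  assume V: "V \<subseteq> X \<and> (\<forall>f\<in>V. \<exists>S e. bounded S \<and> e > 0 \<and> {g \<in> X. \<forall>x\<in>S. \<bar>g x - f x\<bar> < e} \<subseteq> V)"
  show "openin (subtopology bounded_uniform_topology X) V"
  proof (subst openin_subopen, intro ballI)
    fix f assume f: "f \<in> V"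
    then obtain S e where S: "bounded S" "e > 0" "{g \<in> X. \<forall>x\<in>S. \<bar>g x - f x\<bar> < e} \<subseteq> V"
      using V by auto
    have "f \<in> pointed_continuous" using f V assms by auto
    then obtain W where W: "openin bounded_uniform_topology W" "f \<in> W"
      "\<forall>g\<in>W. \<forall>x\<in>S. \<bar>g x - f x\<bar> < e"
      using bounded_uniform_nbhd[OF _ S(1,2), of f] by auto
    have "openin (subtopology bounded_uniform_topology X) (W \<inter> X)"
      using W(1) by (auto simp: openin_subtopology)
    moreover have "f \<in> W \<inter> X" using f V W(2) by auto
    moreover have "W \<inter> X \<subseteq> V" using S(3) W(3) by auto
    ultimately show "\<exists>T. openin (subtopology bounded_uniform_topology X) T \<and> f \<in> T \<and> T \<subseteq> V"
      by (intro exI[of _ "W \<inter> X"]) simp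
  qed
qed

section \<open>Transport of a topology along a bijection\<close>

lemma openin_homeomorphic_image:
  assumes "homeomorphic_map X T f"
  shows "openin T V \<longleftrightarrow> V \<subseteq> topspace T \<and> openin X {x \<in> topspace X. f x \<in> V}"
  using assms openin_subset[of T V] unfolding homeomorphic_map_def quotient_map_def by auto

text \<open>Existence: pull the topology back along the inverse \<open>g\<close>. Uniqueness:
  \<open>openin_homeomorphic_image\<close> expresses the open sets through \<open>X\<close> and
  \<open>f\<close> alone.\<close>

lemma ex1_homeomorphic_topology:
  assumes "inj_on f (topspace X)" "f ` topspace X = A"
  shows "\<exists>!T. topspace T = A \<and> homeomorphic_map X T f"
proof (rule ex_ex1I)
  define g where "g = inv_into (topspace X) f"
  define T where "T = pullback_topology A g X"
  have gf: "g (f x) = x" if "x \<in> topspace X" for x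
    using that assms(1) by (simp add: g_def)
  have fg: "f (g y) = y" "g y \<in> topspace X" if "y \<in> A" for y
    using that assms(2) unfolding g_def by (auto intro: f_inv_into_f inv_into_into)
  have top: "topspace T = A"
    unfolding T_def topspace_pullback_topology using fg(2) by auto
  have "openin X {x \<in> topspace X. f x \<in> U} \<longleftrightarrow> openin T U" if U: "U \<subseteq> A" for U
  proof
    assume "openin X {x \<in> topspace X. f x \<in> U}"
    moreover have "U = g -` {x \<in> topspace X. f x \<in> U} \<inter> A" using U fg by auto
    ultimately show "openin T U" unfolding T_def openin_pullback_topology by blast
  next
    assume "openin T U"
    then obtain W where W: "openin X W" "U = g -` W \<inter> A"
      unfolding T_def openin_pullback_topology by blast
    moreover have "W \<subseteq> topspace X" using openin_subset[OF W(1)] .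
    ultimately have "f x \<in> U \<longleftrightarrow> x \<in> W" if "x \<in> topspace X" for x
      using gf[OF that] that assms(2) by auto
    then have "{x \<in> topspace X. f x \<in> U} = W" using \<open>W \<subseteq> topspace X\<close> by auto
    with W show "openin X {x \<in> topspace X. f x \<in> U}" by simp
  qed
  then have "homeomorphic_map X T f"
    unfolding homeomorphic_map_def quotient_map_def using assms top by auto
  with top show "\<exists>T. topspace T = A \<and> homeomorphic_map X T f" by blast
next
  fix T T' assume "topspace T = A \<and> homeomorphic_map X T f" "topspace T' = A \<and> homeomorphic_map X T' f"
  then show "T = T'"
    unfolding topology_eq using openin_homeomorphic_image[of X T f] openin_homeomorphic_image[of X T' f]
    by auto
qed

section \<open>The functionals and their maxima\<close>

text \<open>What the argument retains of the polyhedron: \<open>positive\<close> excludes rays in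
  the unit ball, that is, expresses its boundedness, and \<open>irredundant\<close> gives every
  facet a point lying on no other facet.\<close>

locale polyhedral_norm =
  fixes \<xi> :: "nat \<Rightarrow> 'a::euclidean_space \<Rightarrow> real" and K :: "nat set"
  assumes finite_K: "finite K"
    and linear_xi: "k \<in> K \<Longrightarrow> linear (\<xi> k)"
    and positive: "w \<noteq> 0 \<Longrightarrow> \<exists>k\<in>K. \<xi> k w > 0"
    and irredundant: "k \<in> K \<Longrightarrow> \<exists>v. \<xi> k v = 1 \<and> (\<forall>j\<in>K - {k}. \<xi> j v < 1)"
begin

abbreviation "N \<equiv> nu \<xi>"
abbreviation "HH \<equiv> H \<xi>"
abbreviation "HP \<equiv> Hplus \<xi> K"
abbreviation "faces \<equiv> dual_faces \<xi> K \<union> {K}"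

lemma xi_simps:
  assumes "k \<in> K"
  shows "\<xi> k (x + y) = \<xi> k x + \<xi> k y" "\<xi> k (x - y) = \<xi> k x - \<xi> k y"
    "\<xi> k (c *\<^sub>R x) = c * \<xi> k x" "\<xi> k (- x) = - \<xi> k x" "\<xi> k 0 = 0"
  using linear_xi[OF assms]
  by (simp_all add: linear_add linear_diff linear_scale linear_neg linear_0)

lemma K_nonempty: "K \<noteq> {}"
proof -
  obtain b :: 'a where "b \<in> Basis" using nonempty_Basis by blast
  then have "b \<noteq> 0" by (auto simp: nonzero_Basis)
  from positive[OF this] show ?thesis by auto
qed

lemma xi_bound: obtains C where "C > 0" "\<And>k u. k \<in> K \<Longrightarrow> \<bar>\<xi> k u\<bar> \<le> C * norm u"
proof -
  have "\<forall>k\<in>K. \<exists>B>0. \<forall>x. norm (\<xi> k x) \<le> B * norm x"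
    using linear_bounded_pos[OF linear_xi] by blast
  then obtain B where B: "\<And>k. k \<in> K \<Longrightarrow> B k > 0 \<and> (\<forall>x. norm (\<xi> k x) \<le> B k * norm x)"
    by metis
  show ?thesis
  proof
    show "1 + sum B K > 0" using B by (simp add: add_pos_nonneg sum_nonneg less_imp_le)
    fix k and u :: 'a assume k: "k \<in> K"
    have "B k \<le> sum B K" using B k finite_K by (intro member_le_sum) (auto simp: less_imp_le)
    then have "B k * norm u \<le> (1 + sum B K) * norm u" by (intro mult_right_mono) auto
    then show "\<bar>\<xi> k u\<bar> \<le> (1 + sum B K) * norm u" using B[OF k] by (metis order_trans real_norm_def)
  qed
qed

lemma finite_sub: "L \<subseteq> K \<Longrightarrow> finite L"
  using finite_K finite_subset by blast

lemma nu_ge: "L \<subseteq> K \<Longrightarrow> l \<in> L \<Longrightarrow> \<xi> l u \<le> N L u"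
  unfolding nu_def using finite_sub by auto

lemma nu_attained: "L \<subseteq> K \<Longrightarrow> L \<noteq> {} \<Longrightarrow> \<exists>l\<in>L. N L u = \<xi> l u"
  unfolding nu_def using Max_in[of "(\<lambda>l. \<xi> l u) ` L"] finite_sub[of L] by blast

lemma nu_le: "L \<subseteq> K \<Longrightarrow> L \<noteq> {} \<Longrightarrow> (\<And>l. l \<in> L \<Longrightarrow> \<xi> l u \<le> c) \<Longrightarrow> N L u \<le> c"
  by (metis nu_attained)

lemma nu_eqI: "L \<subseteq> K \<Longrightarrow> k \<in> L \<Longrightarrow> (\<And>l. l \<in> L \<Longrightarrow> \<xi> l u \<le> \<xi> k u) \<Longrightarrow> N L u = \<xi> k u"
  by (intro antisym nu_le nu_ge) auto

text \<open>The functionals indexed by \<open>L\<close> agree at \<open>w\<close>, so their maximum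
  is shifted by the common value.\<close>

lemma nu_add_H:
  assumes "L \<subseteq> K" "l \<in> L" "w \<in> HH L"
  shows "N L (u + w) = N L u + \<xi> l w"
proof -
  obtain k where k: "k \<in> L" "N L u = \<xi> k u" using nu_attained assms by blast
  have w: "\<xi> j w = \<xi> l w" if "j \<in> L" for j using assms that unfolding H_def by blast
  have "N L (u + w) = \<xi> k (u + w)"
  proof (rule nu_eqI)
    fix j assume j: "j \<in> L"
    have "\<xi> j u \<le> \<xi> k u" using nu_ge[OF assms(1) j, of u] k by simp
    moreover have "j \<in> K" "k \<in> K" using j k assms by auto
    ultimately show "\<xi> j (u + w) \<le> \<xi> k (u + w)"
      using w[OF j] w[OF k(1)] by (simp add: xi_simps)
  qed (use assms k in auto)
  moreover have "k \<in> K" using k assms by auto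
  ultimately show ?thesis using k w[OF k(1)] by (simp add: xi_simps)
qed

lemma nu_lipschitz:
  assumes "L \<subseteq> K" "L \<noteq> {}" "\<And>k u. k \<in> K \<Longrightarrow> \<bar>\<xi> k u\<bar> \<le> C * norm u"
  shows "\<bar>N L u - N L v\<bar> \<le> C * norm (u - v)"
proof -
  have *: "N L u \<le> N L v + C * norm (u - v)" for u v
  proof (rule nu_le[OF assms(1,2)])
    fix l assume l: "l \<in> L"
    then have "l \<in> K" using assms by auto
    then have "\<xi> l u - \<xi> l v \<le> C * norm (u - v)"
      using assms(3)[of l "u - v"] by (simp add: xi_simps)
    then show "\<xi> l u \<le> N L v + C * norm (u - v)" using nu_ge[OF assms(1) l, of v] by linarith
  qed
  from *[of u v] *[of v u] show ?thesis by (simp add: norm_minus_commute)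
qed

lemma nu_restrict:
  assumes "L \<subseteq> L'" "L' \<subseteq> K" "L \<noteq> {}"
    and "\<And>l j. l \<in> L \<Longrightarrow> j \<in> L' - L \<Longrightarrow> \<xi> j u \<le> \<xi> l u"
  shows "N L' u = N L u"
proof -
  have LK: "L \<subseteq> K" using assms by blast
  obtain k where k: "k \<in> L" "N L u = \<xi> k u" using nu_attained[OF LK assms(3)] by blast
  have "N L' u = \<xi> k u"
  proof (rule nu_eqI)
    fix j assume "j \<in> L'"
    then show "\<xi> j u \<le> \<xi> k u"
      using nu_ge[OF LK, of j u] k assms(4)[of k j] by (cases "j \<in> L") auto
  qed (use assms k in auto)
  then show ?thesis using k by simp
qed

section \<open>The subspaces \<open>HH L\<close>, the cones \<open>HP L\<close>, and the dual
  faces\<close>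

lemma subspace_H:
  assumes "L \<subseteq> K"
  shows "subspace (HH L)"
proof -
  have K: "k \<in> K" if "k \<in> L" for k using that assms by auto
  have "HH L = (\<Inter>k\<in>L. \<Inter>l\<in>L. {u. \<xi> k u - \<xi> l u = 0})"
    unfolding H_def by auto
  moreover have "subspace {u. \<xi> k u - \<xi> l u = 0}" if "k \<in> L" "l \<in> L" for k l
    using K[OF that(1)] K[OF that(2)] by (intro linear_subspace_kernel linear_compose_sub linear_xi)
  ultimately show ?thesis by (auto intro!: subspace_Inter)
qed

lemmas H_closed = subspace_0[OF subspace_H] subspace_add[OF subspace_H]
  subspace_diff[OF subspace_H] subspace_scale[OF subspace_H] subspace_neg[OF subspace_H]

lemma H_antimono: "L \<subseteq> L' \<Longrightarrow> HH L' \<subseteq> HH L"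
  unfolding H_def by blast

lemma Hplus_subset: "HP L \<subseteq> HH L"
  unfolding Hplus_def by blast

text \<open>If all functionals agree at \<open>w \<noteq> 0\<close>, then \<open>positive\<close>
  makes the common value positive at \<open>w\<close> and also at \<open>- w\<close>.\<close>

lemma H_K: "HH K = {0}"
proof -
  have "w = 0" if w: "w \<in> HH K" for w
  proof (rule ccontr)
    assume "w \<noteq> 0"
    then obtain k l where "k \<in> K" "\<xi> k w > 0" "l \<in> K" "\<xi> l (- w) > 0"
      using positive[of w] positive[of "- w"] by auto
    moreover from this have "\<xi> k w = \<xi> l w" using w unfolding H_def by blast
    ultimately show False by (simp add: xi_simps)
  qed
  then show ?thesis using H_closed(1)[of K] by auto
qed

lemma Hplus_K: "HP K = {0}"
  unfolding Hplus_def using H_K by auto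

text \<open>For \<open>l \<in> L\<close> and \<open>k \<in> K - L\<close> the vector
  \<open>u\<close> gives only a weak inequality, with equality if \<open>k \<in> L'\<close>;
  strictness comes from \<open>w\<close>. Thus tubes absorb the cones of larger faces.\<close>

lemma Hplus_add:
  assumes "L \<subseteq> L'" "L' \<subseteq> K" "u \<in> HP L'" "w \<in> HP L"
  shows "u + w \<in> HP L"
proof -
  have 1: "u + w \<in> HH L"
    using assms Hplus_subset[of L] Hplus_subset[of L'] H_antimono[of L L'] by (intro H_closed) auto
  have "\<xi> l (u + w) > \<xi> k (u + w)" if lk: "l \<in> L" "k \<in> K - L" for l k
  proof -
    have "\<xi> k u \<le> \<xi> l u"
    proof (cases "k \<in> L'")
      case True
      then have "\<xi> k u = \<xi> l u"
        using assms lk unfolding Hplus_def H_def by blast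
      then show ?thesis by simp
    next
      case False
      then have "\<xi> k u < \<xi> l u"
        using assms lk unfolding Hplus_def by blast
      then show ?thesis by simp
    qed
    moreover have "\<xi> k w < \<xi> l w" using assms lk unfolding Hplus_def by blast
    moreover have "l \<in> K" "k \<in> K" using assms lk by auto
    ultimately show ?thesis by (simp add: xi_simps)
  qed
  with 1 show ?thesis unfolding Hplus_def by blast
qed

lemma Hplus_scale:
  assumes "L \<subseteq> K" "w \<in> HP L" "t > 0"
  shows "t *\<^sub>R w \<in> HP L"
  using assms H_closed(4)[OF assms(1), of w t] unfolding Hplus_def
  by (auto simp: xi_simps subset_iff)

text \<open>Otherwise all functionals would take the value 1 at a point of \<open>HH K\<close>,
  which is 0. This keeps the two branches of \<open>point\<close> apart.\<close>

lemma K_notin_dual_faces: "K \<notin> dual_faces \<xi> K"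
proof
  assume "K \<in> dual_faces \<xi> K"
  then obtain v where v: "\<And>k. k \<in> K \<Longrightarrow> \<xi> k v = 1" unfolding dual_faces_def by blast
  then have "v \<in> HH K" unfolding H_def by auto
  then have "v = 0" using H_K by auto
  then show False using v K_nonempty xi_simps(5) by force
qed

text \<open>The point defining a dual face lies in the cone. Conversely, for
  \<open>L \<noteq> K\<close> a vector of the cone is nonzero, so some functional is positive there;
  hence the common value on \<open>L\<close>, being the largest, is positive and can be scaled to
  1.\<close>

lemma faces_iff: "L \<in> faces \<longleftrightarrow> L \<noteq> {} \<and> L \<subseteq> K \<and> HP L \<noteq> {}"
proof (cases "L = K")
  case True
  then show ?thesis using K_nonempty Hplus_K by auto
next
  case False
  show ?thesis
  proof
    assume "L \<in> faces"
    then obtain v where L: "L \<noteq> {}" "L \<subseteq> K" and v: "N K v = 1" "L = {k \<in> K. \<xi> k v = 1}"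
      using False unfolding dual_faces_def by blast
    have "\<xi> k v < 1" if "k \<in> K - L" for k
      using nu_ge[of K k v] v that by force
    then have "v \<in> HP L" using v(2) unfolding Hplus_def H_def by force
    with L show "L \<noteq> {} \<and> L \<subseteq> K \<and> HP L \<noteq> {}" by auto
  next
    assume "L \<noteq> {} \<and> L \<subseteq> K \<and> HP L \<noteq> {}"
    then obtain l w where L: "L \<subseteq> K" "l \<in> L" "w \<in> HP L" by blast
    then obtain j where j: "j \<in> K - L" using False by blast
    have eq: "\<xi> k w = \<xi> l w" if "k \<in> L" for k
      using L that unfolding Hplus_def H_def by blast
    have less: "\<xi> k w < \<xi> l w" if "k \<in> K - L" for k
      using L that unfolding Hplus_def by blast
    have lK: "l \<in> K" using L by auto
    have "w \<noteq> 0" using less[OF j] j lK by (auto simp: xi_simps)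
    then obtain k where "k \<in> K" "\<xi> k w > 0" using positive by blast
    then have pos: "\<xi> l w > 0" using eq[of k] less[of k] by (cases "k \<in> L") auto
    define v where "v = (1 / \<xi> l w) *\<^sub>R w"
    have xv: "\<xi> k v = \<xi> k w / \<xi> l w" if "k \<in> K" for k
      using that by (simp add: v_def xi_simps)
    have 1: "\<xi> l v = 1" using xv[OF lK] pos by simp
    have "N K v = \<xi> l v"
    proof (rule nu_eqI[OF subset_refl lK])
      fix k assume k: "k \<in> K"
      then have "\<xi> k w \<le> \<xi> l w" using eq[of k] less[of k] by (cases "k \<in> L") auto
      then show "\<xi> k v \<le> \<xi> l v" using 1 xv[OF k] pos by simp
    qed
    moreover have "L = {k \<in> K. \<xi> k v = 1}"
    proof (rule set_eqI)
      fix k show "k \<in> L \<longleftrightarrow> k \<in> {k \<in> K. \<xi> k v = 1}"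
        using L(1) eq[of k] less[of k] xv[of k] pos by (cases "k \<in> L") (auto simp: field_simps)
    qed
    ultimately have "L \<in> dual_faces \<xi> K" unfolding dual_faces_def using L 1 by auto
    then show "L \<in> faces" by simp
  qed
qed

lemma faceD: "L \<in> faces \<Longrightarrow> L \<subseteq> K" "L \<in> faces \<Longrightarrow> L \<noteq> {}"
  "L \<in> faces \<Longrightarrow> \<exists>w. w \<in> HP L"
  by (auto simp only: faces_iff)

section \<open>Dependence of horofunctions on their parameters\<close>

text \<open>By \<open>nu_add_H\<close> both terms of the difference change by the same amount; so
  \<open>horo \<xi> L p\<close> depends only on the coset of \<open>p\<close>.\<close>

lemma horo_shift:
  assumes "L \<subseteq> K" "L \<noteq> {}" "w \<in> HH L"
  shows "horo \<xi> L (p + w) = horo \<xi> L p"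
proof
  fix v
  obtain l where "l \<in> L" using assms by blast
  then show "horo \<xi> L (p + w) v = horo \<xi> L p v"
    using nu_add_H[OF assms(1) _ assms(3), of l "p - v"] nu_add_H[OF assms(1) _ assms(3), of l p]
    by (simp add: horo_def algebra_simps)
qed

text \<open>A quantitative splitting: the functionals \<open>\<xi> k - \<xi> l\<close> with \<open>k, l \<in> L\<close> control
  the distance to their common kernel \<open>H\<^sub>L\<close>.\<close>

lemma H_distance:
  assumes "L \<subseteq> K"
  shows "\<exists>C>0. \<forall>u d. (\<forall>k\<in>L. \<forall>l\<in>L. \<bar>\<xi> k u - \<xi> l u\<bar> \<le> d) \<longrightarrow> d \<ge> 0 \<longrightarrow>
    (\<exists>c. u - c \<in> HH L \<and> norm c \<le> C * d)"
proof -
  \<comment> \<open>\<open>f\<close> is a seminorm with kernel \<open>HH L\<close>. On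
    \<open>T\<close>, the unit sphere of the orthogonal complement of \<open>HH L\<close>, it has a
    positive minimum by compactness.\<close>
  define f where "f u = (\<Sum>k\<in>L. \<Sum>l\<in>L. \<bar>\<xi> k u - \<xi> l u\<bar>)" for u
  define T where "T = {x. \<forall>y\<in>HH L. orthogonal y x} \<inter> sphere 0 1"
  have fin: "finite L" using finite_sub assms by blast
  have f_ge: "\<bar>\<xi> k u - \<xi> l u\<bar> \<le> f u" if "k \<in> L" "l \<in> L" for k l u
  proof -
    have "\<bar>\<xi> k u - \<xi> l u\<bar> \<le> (\<Sum>l\<in>L. \<bar>\<xi> k u - \<xi> l u\<bar>)"
      by (rule member_le_sum[OF that(2) _ fin]) simp
    also have "\<dots> \<le> f u"
      unfolding f_def by (rule member_le_sum[OF that(1) _ fin]) (simp add: sum_nonneg)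
    finally show ?thesis .
  qed
  have f0: "u \<in> HH L" if "f u = 0" for u
  proof -
    have "\<xi> k u = \<xi> l u" if "k \<in> L" "l \<in> L" for k l
      using f_ge[OF that, of u] \<open>f u = 0\<close> by linarith
    then show ?thesis unfolding H_def by blast
  qed
  have fscale: "f (c *\<^sub>R u) = \<bar>c\<bar> * f u" for c u
  proof -
    have "\<bar>\<xi> k (c *\<^sub>R u) - \<xi> l (c *\<^sub>R u)\<bar> = \<bar>c\<bar> * \<bar>\<xi> k u - \<xi> l u\<bar>" if "k \<in> L" "l \<in> L" for k l
    proof -
      have "k \<in> K" "l \<in> K" using that assms by auto
      then show ?thesis by (simp only: xi_simps right_diff_distrib[symmetric] abs_mult)
    qed
    then show ?thesis unfolding f_def by (simp add: sum_distrib_left)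
  qed
  have conf: "continuous_on A f" for A
  proof -
    have "continuous_on A (\<xi> k)" if "k \<in> L" for k
      using assms that linear_xi by (auto intro!: linear_continuous_on simp: linear_conv_bounded_linear)
    then show ?thesis
      unfolding f_def by (intro continuous_on_sum continuous_on_rabs continuous_on_diff)
  qed
  have compT: "compact T"
    unfolding T_def
    by (rule closed_Int_compact[OF closed_subspace[OF subspace_orthogonal_to_vectors] compact_sphere])
  have "\<exists>m>0. \<forall>x\<in>T. f x \<ge> m"
  proof (cases "T = {}")
    \<comment> \<open>This occurs when \<open>HH L\<close> is the whole space, for instance for a
      singleton \<open>L\<close>.\<close>
    case True then show ?thesis by (auto intro: exI[of _ 1])
  next
    case False
    then obtain z where z: "z \<in> T" "\<forall>x\<in>T. f z \<le> f x"
      using continuous_attains_inf[OF compT False conf] by blast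
    have "f z \<noteq> 0"
    proof
      assume "f z = 0"
      then have "orthogonal z z" using f0 z unfolding T_def by blast
      then show False using z unfolding T_def by (simp add: orthogonal_self)
    qed
    moreover have "f z \<ge> 0" unfolding f_def by (intro sum_nonneg) auto
    ultimately show ?thesis using z by (intro exI[of _ "f z"]) auto
  qed
  then obtain m where m: "m > 0" "\<And>x. x \<in> T \<Longrightarrow> f x \<ge> m" by blast
  show ?thesis
  \<comment> \<open>The double sum has \<open>card L * card L\<close> terms, each at most
    \<open>d\<close>; the summand 1 keeps the constant positive for empty \<open>L\<close>.\<close>
  proof (intro exI[of _ "(1 + card L * card L) / m"] conjI allI impI)
    show "(1 + card L * card L) / m > 0" using m by (simp add: add_pos_nonneg)
    fix u :: 'a and d :: real
    assume "\<forall>k\<in>L. \<forall>l\<in>L. \<bar>\<xi> k u - \<xi> l u\<bar> \<le> d" and d: "d \<ge> 0"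
    obtain y z where yz: "y \<in> span (HH L)" "\<And>w. w \<in> span (HH L) \<Longrightarrow> orthogonal z w" "u = y + z"
      using orthogonal_subspace_decomp_exists[of "HH L" u] by blast
    have y: "y \<in> HH L" using yz subspace_H[OF assms] span_eq_iff by blast
    have fz: "f z = f u"
      unfolding f_def
    proof (intro sum.cong refl)
      fix k l assume kl: "k \<in> L" "l \<in> L"
      then have "\<xi> k y = \<xi> l y" using y unfolding H_def by blast
      moreover have "k \<in> K" "l \<in> K" using kl assms by auto
      ultimately show "\<bar>\<xi> k z - \<xi> l z\<bar> = \<bar>\<xi> k u - \<xi> l u\<bar>" using yz by (simp add: xi_simps)
    qed
    have "f u \<le> (\<Sum>k\<in>L. \<Sum>l\<in>L. d)" unfolding f_def
      using \<open>\<forall>k\<in>L. \<forall>l\<in>L. \<bar>\<xi> k u - \<xi> l u\<bar> \<le> d\<close> by (intro sum_mono) blast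
    also have "\<dots> \<le> (1 + card L * card L) * d" using d by (simp add: algebra_simps)
    finally have fu: "f u \<le> (1 + card L * card L) * d" .
    have "m * norm z \<le> f z"
    proof (cases "z = 0")
      case True
      then show ?thesis using fscale[of 0 0] by simp
    next
      case False
      have "(1 / norm z) *\<^sub>R z \<in> T"
        unfolding T_def using False yz(2)[OF span_base]
        by (auto simp: orthogonal_def inner_commute)
      then have "m \<le> f ((1 / norm z) *\<^sub>R z)" by (rule m)
      then show ?thesis using False by (simp add: fscale field_simps)
    qed
    then have "norm z \<le> (1 + card L * card L) / m * d"
      using fz fu m by (simp add: field_simps)
    moreover have "u - z \<in> HH L" using yz y by simp
    ultimately show "\<exists>c. u - c \<in> HH L \<and> norm c \<le> (1 + card L * card L) / m * d" by blast
  qed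
qed

lemma horo_lipschitz:
  assumes "L \<subseteq> K" "L \<noteq> {}" "\<And>k u. k \<in> K \<Longrightarrow> \<bar>\<xi> k u\<bar> \<le> C * norm u"
  shows "\<bar>horo \<xi> L p v - horo \<xi> L p w\<bar> \<le> C * norm (v - w)"
    and "\<bar>horo \<xi> L (p + b) v - horo \<xi> L p v\<bar> \<le> 2 * C * norm b"
proof -
  show "\<bar>horo \<xi> L p v - horo \<xi> L p w\<bar> \<le> C * norm (v - w)"
    using nu_lipschitz[OF assms, of "p - v" "p - w"] by (simp add: horo_def norm_minus_commute)
  show "\<bar>horo \<xi> L (p + b) v - horo \<xi> L p v\<bar> \<le> 2 * C * norm b"
    using nu_lipschitz[OF assms, of "p + b - v" "p - v"] nu_lipschitz[OF assms, of "p + b" p]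
    by (simp add: horo_def algebra_simps)
qed

lemma horo_pointed_continuous:
  assumes "L \<in> faces"
  shows "horo \<xi> L p \<in> pointed_continuous"
proof -
  obtain C where C: "C > 0" "\<And>k u. k \<in> K \<Longrightarrow> \<bar>\<xi> k u\<bar> \<le> C * norm u" using xi_bound by blast
  have "C-lipschitz_on UNIV (horo \<xi> L p)"
    using horo_lipschitz(1)[OF faceD(1,2)[OF assms] C(2)] C(1)
    by (intro lipschitz_onI) (simp_all add: dist_norm)
  then have "continuous_on UNIV (horo \<xi> L p)" by (rule lipschitz_on_continuous_on)
  then show ?thesis unfolding pointed_continuous_def by (simp add: horo_def)
qed

section \<open>Recovering the face and the coset from finitely many values\<close>

text \<open>With a common margin, a multiple of \<open>w\<close> by \<open>t > 0\<close> separates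
  \<open>L\<close> from its complement by at least \<open>t * d\<close>.\<close>

lemma Hplus_gap:
  assumes "L \<subseteq> K" "w \<in> HP L"
  obtains d where "d > 0" "\<And>l k. l \<in> L \<Longrightarrow> k \<in> K - L \<Longrightarrow> d \<le> \<xi> l w - \<xi> k w"
proof -
  let ?P = "(\<lambda>(l, k). \<xi> l w - \<xi> k w) ` (L \<times> (K - L))"
  have "finite ?P" using finite_sub[OF assms(1)] finite_K by blast
  moreover have "x > 0" if "x \<in> ?P" for x using that assms(2) unfolding Hplus_def by auto
  ultimately obtain d where "d > 0" "\<forall>x\<in>?P. d \<le> x" using finite_gap by blast
  then show ?thesis by (intro that[of d]) auto
qed

text \<open>The uniform gap \<open>c\<close> decides how far out on the rays one has to go for a
  single functional to become recognizable.\<close>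

lemma peaks:
  "\<exists>v c. c > 0 \<and> (\<forall>k\<in>K. \<xi> k (v k) = 1 \<and> (\<forall>j\<in>K. j \<noteq> k \<longrightarrow> \<xi> j (v k) \<le> 1 - c))"
proof -
  have "\<forall>k\<in>K. \<exists>v. \<xi> k v = 1 \<and> (\<forall>j\<in>K - {k}. \<xi> j v < 1)"
    using irredundant by blast
  from bchoice[OF this] obtain v
    where v: "\<And>k. k \<in> K \<Longrightarrow> \<xi> k (v k) = 1 \<and> (\<forall>j\<in>K - {k}. \<xi> j (v k) < 1)" by blast
  define P where "P = (\<lambda>(j, k). 1 - \<xi> j (v k)) ` {(j, k) \<in> K \<times> K. j \<noteq> k}"
  have "finite {(j, k) \<in> K \<times> K. j \<noteq> k}"
    by (rule finite_subset[of _ "K \<times> K"]) (use finite_K in auto)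
  then have "finite P" unfolding P_def by (rule finite_imageI)
  moreover have "x > 0" if "x \<in> P" for x using that v unfolding P_def by auto
  ultimately obtain c where c: "c > 0" "\<forall>x\<in>P. c \<le> x" using finite_gap[of P] by blast
  have "\<xi> j (v k) \<le> 1 - c" if "j \<in> K" "k \<in> K" "j \<noteq> k" for j k
  proof -
    have "(j, k) \<in> {(j, k) \<in> K \<times> K. j \<noteq> k}" using that by simp
    from bspec[OF c(2)[unfolded P_def] imageI[OF this]] show ?thesis by simp
  qed
  with c v show ?thesis by (intro exI[of _ v] exI[of _ c]) auto
qed

text \<open>Far out along the ray through the \<open>k\<close>-th peak, the \<open>k\<close>-th functional alone determines
  a horofunction; this is how the set \<open>L\<close> and the coset of \<open>p\<close> are recovered from finitely
  many values.\<close>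

lemma horo_peak:
  assumes "L \<subseteq> K" "L \<noteq> {}" "k \<in> K" "s \<ge> 0" "\<xi> k v = 1"
    and "\<forall>j\<in>K. j \<noteq> k \<longrightarrow> \<xi> j v \<le> 1 - c"
  shows "k \<in> L \<Longrightarrow> \<xi> k p - N L p + s \<le> horo \<xi> L p (- (s *\<^sub>R v))"
    and "s * (1 - c) < horo \<xi> L p (- (s *\<^sub>R v)) \<Longrightarrow>
      k \<in> L \<and> horo \<xi> L p (- (s *\<^sub>R v)) = \<xi> k p - N L p + s"
proof -
  show "\<xi> k p - N L p + s \<le> horo \<xi> L p (- (s *\<^sub>R v))" if "k \<in> L"
    using nu_ge[OF assms(1) that, of "p + s *\<^sub>R v"] assms by (simp add: horo_def xi_simps)
  assume gt: "s * (1 - c) < horo \<xi> L p (- (s *\<^sub>R v))"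
  obtain j where j: "j \<in> L" "N L (p + s *\<^sub>R v) = \<xi> j (p + s *\<^sub>R v)"
    using nu_attained[OF assms(1,2)] by blast
  have jK: "j \<in> K" using j assms by auto
  have eq: "horo \<xi> L p (- (s *\<^sub>R v)) = \<xi> j p - N L p + s * \<xi> j v"
    using j(2) jK by (simp add: horo_def xi_simps)
  \<comment> \<open>For any other \<open>j\<close> the value would not exceed
    \<open>s * (1 - c)\<close>, since \<open>\<xi> j p - N L p\<close> is nonpositive.\<close>
  have "j = k"
  proof (rule ccontr)
    assume "j \<noteq> k"
    then have "s * \<xi> j v \<le> s * (1 - c)" using assms jK by (intro mult_left_mono) auto
    then show False using gt eq nu_ge[OF assms(1) j(1), of p] by linarith
  qed
  then show "k \<in> L \<and> horo \<xi> L p (- (s *\<^sub>R v)) = \<xi> k p - N L p + s"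
    using eq j assms by simp
qed

text \<open>The points of \<open>S\<close> lie far out opposite the peaks. At those of
  \<open>L\<close> both functions exceed the threshold \<open>s * (1 - g)\<close>, which yields
  \<open>L \<subseteq> L'\<close> and nearly equal normalized values; for
  \<open>k \<in> L' - L\<close> the normalized value of \<open>p\<close> is very negative. Hence
  \<open>p - q\<close> is close to some \<open>y \<in> HH L\<close>, and a long shift along
  \<open>HP L'\<close> moves \<open>y\<close> into \<open>HP L\<close>.\<close>

lemma horo_near:
  assumes L: "L \<in> faces" and "\<epsilon> > 0"
  shows "\<exists>S e. bounded S \<and> e > 0 \<and>
    (\<forall>L'\<in>faces. \<forall>p. (\<forall>x\<in>S. \<bar>horo \<xi> L' p x - horo \<xi> L q x\<bar> < e) \<longrightarrow>
      L \<subseteq> L' \<and> (\<exists>h\<in>HH L'. p + h \<in> tube \<xi> K L \<epsilon> q))"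
proof -
  note LK = faceD(1,2)[OF L]
  obtain C where C: "C > 0" "\<And>k u. k \<in> K \<Longrightarrow> \<bar>\<xi> k u\<bar> \<le> C * norm u" using xi_bound by blast
  obtain D where D: "D > 0" "\<And>u d. \<forall>k\<in>L. \<forall>l\<in>L. \<bar>\<xi> k u - \<xi> l u\<bar> \<le> d \<Longrightarrow> d \<ge> 0 \<Longrightarrow>
    \<exists>c. u - c \<in> HH L \<and> norm c \<le> D * d"
    using H_distance[OF LK(1)] by metis
  obtain v g where v: "g > 0" "\<And>k. k \<in> K \<Longrightarrow> \<xi> k (v k) = 1"
    "\<And>k. k \<in> K \<Longrightarrow> \<forall>j\<in>K. j \<noteq> k \<longrightarrow> \<xi> j (v k) \<le> 1 - g"
    using peaks by metis
  define e where "e = \<epsilon> / (4 * D)"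
  have e: "e > 0" "D * (2 * e) < \<epsilon>" using D(1) \<open>\<epsilon> > 0\<close> by (simp_all add: e_def field_simps)
  \<comment> \<open>\<open>- M\<close> bounds \<open>\<xi> k q - N L q\<close> from below for
    \<open>k \<in> L\<close>. In \<open>R\<close>, the part \<open>M + 2 * e\<close> lifts the
    values at the peaks of \<open>L\<close> above the threshold \<open>s * (1 - g) = s - R\<close>
    in spite of the error \<open>e\<close>. The rest absorbs the contributions of \<open>q\<close>
    and of the vector \<open>c\<close> below when \<open>l \<in> L\<close> is compared with
    \<open>k \<in> L' - L\<close>.\<close>
  define M where "M = 2 * C * norm q"
  define R where "R = M + 2 * e + 2 * C * (norm q + \<epsilon>) + 1"
  define s where "s = R / g"
  have M: "M \<ge> 0" "- M \<le> \<xi> k q - N L q" if "k \<in> L" for k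
  proof -
    show "M \<ge> 0" using C by (simp add: M_def)
    obtain j where j: "j \<in> L" "N L q = \<xi> j q" using nu_attained[OF LK] by blast
    have "j \<in> K" "k \<in> K" using that j LK by auto
    then show "- M \<le> \<xi> k q - N L q" using C(2)[of j q] C(2)[of k q] j by (simp add: M_def)
  qed
  have R: "R > M + 2 * e" "R > 0" "M \<ge> 0" using C e \<open>\<epsilon> > 0\<close> unfolding R_def M_def
    by (simp_all add: add_pos_pos add_nonneg_pos mult_nonneg_nonneg)
  have s: "s > 0" "s * g = R" using R v(1) by (simp_all add: s_def)
  have sg: "s * (1 - g) = s - R" using s(2) by (simp add: algebra_simps)
  define S where "S = (\<lambda>k. - (s *\<^sub>R v k)) ` K"
  show ?thesis
  proof (intro exI[of _ S] exI[of _ e] conjI[of "bounded S"] conjI[of "e > 0"] ballI allI impI)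
    show "bounded S" unfolding S_def using finite_K by (intro finite_imp_bounded) auto
    show "e > 0" by (rule e)
    fix L' p assume L': "L' \<in> faces"
      and close: "\<forall>x\<in>S. \<bar>horo \<xi> L' p x - horo \<xi> L q x\<bar> < e"
    note LK' = faceD(1,2)[OF L']
    define a where "a k = \<xi> k p - N L' p" for k
    define b where "b k = \<xi> k q - N L q" for k
    define x where "x k = - (s *\<^sub>R v k)" for k
    have near: "\<bar>horo \<xi> L' p (x k) - horo \<xi> L q (x k)\<bar> < e" if "k \<in> K" for k
      using close that unfolding S_def x_def by blast
    note pk = horo_peak[OF _ _ _ less_imp_le[OF s(1)] v(2,3), folded x_def]
    have inL: "k \<in> L' \<and> \<bar>a k - b k\<bar> < e" if k: "k \<in> L" for k
    proof -
      have kK: "k \<in> K" using k LK by auto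
      have 1: "b k + s \<le> horo \<xi> L q (x k)"
        using pk(1)[OF LK kK kK kK k] unfolding b_def by simp
      have "b k \<ge> - M" using M(2)[OF k] by (simp add: b_def)
      then have "s * (1 - g) < horo \<xi> L q (x k)" "s * (1 - g) < horo \<xi> L' p (x k)"
        using 1 near[OF kK] R e unfolding sg by linarith+
      then have "horo \<xi> L q (x k) = b k + s" "k \<in> L' \<and> horo \<xi> L' p (x k) = a k + s"
        using pk(2)[OF LK kK kK kK] pk(2)[OF LK' kK kK kK] unfolding a_def b_def by simp_all
      then show ?thesis using near[OF kK] by auto
    qed
    then have sub: "L \<subseteq> L'" by blast
    \<comment> \<open>As \<open>k\<close> is not in \<open>L\<close>, the second part of
      \<open>horo_peak\<close> keeps \<open>horo \<xi> L q\<close> at or below the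
      threshold.\<close>
    have outL: "a k < e - R" if k: "k \<in> L' - L" for k
    proof -
      have kK: "k \<in> K" using k LK' by auto
      have "horo \<xi> L q (x k) \<le> s * (1 - g)"
        using pk(2)[OF LK kK kK kK, of q] k by force
      moreover have "a k + s \<le> horo \<xi> L' p (x k)"
        using pk(1)[OF LK' kK kK kK] k unfolding a_def by simp
      ultimately show ?thesis using near[OF kK] sg by linarith
    qed
    \<comment> \<open>The unknown normalizations \<open>N L' p\<close> and \<open>N L q\<close>
      cancel in the difference.\<close>
    have "\<bar>\<xi> k (p - q) - \<xi> l (p - q)\<bar> \<le> 2 * e" if "k \<in> L" "l \<in> L" for k l
    proof -
      have "k \<in> K" "l \<in> K" using that LK by auto
      then have "\<xi> k (p - q) - \<xi> l (p - q) = (a k - b k) - (a l - b l)"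
        unfolding a_def b_def by (simp add: xi_simps)
      then show ?thesis using inL[OF that(1)] inL[OF that(2)] by linarith
    qed
    then obtain c where c: "p - q - c \<in> HH L" "norm c \<le> D * (2 * e)"
      using D(2)[of "p - q" "2 * e"] e by auto
    then have ce: "norm c < \<epsilon>" using e by linarith
    obtain w where w: "w \<in> HP L'" using faceD(3)[OF L'] by blast
    obtain d where d: "d > 0" "\<And>l k. l \<in> L' \<Longrightarrow> k \<in> K - L' \<Longrightarrow> d \<le> \<xi> l w - \<xi> k w"
      using Hplus_gap[OF LK'(1) w] by blast
    define y where "y = p - q - c"
    \<comment> \<open>Chosen so that \<open>t * d\<close> exceeds any difference of two functionals
      at \<open>y\<close>.\<close>
    define t where "t = (2 * C * norm y + 1) / d"
    have t: "t > 0" "t * d = 2 * C * norm y + 1"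
      using C d by (simp_all add: t_def add_nonneg_pos)
    have tw: "t *\<^sub>R w \<in> HH L'"
      using w Hplus_subset[of L'] H_closed(4)[OF LK'(1)] by blast
    \<comment> \<open>For \<open>k \<in> L' - L\<close> the vector \<open>w\<close> does not
      distinguish \<open>k\<close> from \<open>l\<close>, and the inequality comes from the size of
      \<open>R\<close>; for \<open>k\<close> outside \<open>L'\<close> the shift along
      \<open>w\<close> dominates.\<close>
    have "y + t *\<^sub>R w \<in> HP L"
    proof -
      have "y + t *\<^sub>R w \<in> HH L"
        using c(1) tw H_antimono[OF sub] unfolding y_def by (intro H_closed(2) LK) blast+
      moreover have "\<xi> l (y + t *\<^sub>R w) > \<xi> k (y + t *\<^sub>R w)" if lk: "l \<in> L" "k \<in> K - L" for l k
      proof (cases "k \<in> L'")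
        case True
        have K: "l \<in> K" "k \<in> K" using lk LK by auto
        have wlk: "\<xi> l w = \<xi> k w"
          using w True lk sub Hplus_subset[of L'] unfolding H_def by blast
        have "\<xi> l y - \<xi> k y = (a l - a k) - (\<xi> l q - \<xi> k q) - (\<xi> l c - \<xi> k c)"
          using K by (simp add: y_def a_def xi_simps)
        moreover have "a l - a k > b l - e - (e - R)"
          using inL[OF lk(1)] outL[of k] True lk by auto
        moreover have "b l \<ge> - M" using M(2)[OF lk(1)] by (simp add: b_def)
        moreover have "C * norm c \<le> C * \<epsilon>" using ce C by simp
        moreover have "\<bar>\<xi> l q\<bar> \<le> C * norm q" "\<bar>\<xi> k q\<bar> \<le> C * norm q"
          "\<bar>\<xi> l c\<bar> \<le> C * norm c" "\<bar>\<xi> k c\<bar> \<le> C * norm c" using C K by auto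
        moreover have "R = M + 2 * e + 2 * (C * norm q) + 2 * (C * \<epsilon>) + 1"
          by (simp add: R_def algebra_simps)
        ultimately have "\<xi> l y > \<xi> k y" by linarith
        then show ?thesis using K wlk by (simp add: xi_simps)
      next
        case False
        have K: "l \<in> K" "k \<in> K" using lk LK by auto
        have "t * d \<le> t * (\<xi> l w - \<xi> k w)"
          using d(2)[of l k] lk False sub t by (intro mult_left_mono) auto
        moreover have "\<bar>\<xi> l y\<bar> \<le> C * norm y" "\<bar>\<xi> k y\<bar> \<le> C * norm y" using C K by auto
        ultimately have "t * (\<xi> l w - \<xi> k w) > \<xi> k y - \<xi> l y" using t(2) by linarith
        then show ?thesis using K by (simp add: xi_simps algebra_simps)
      qed
      ultimately show ?thesis unfolding Hplus_def by blast
    qed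
    moreover have "p + t *\<^sub>R w = q + c + (y + t *\<^sub>R w)" by (simp add: y_def)
    ultimately have "p + t *\<^sub>R w \<in> tube \<xi> K L \<epsilon> q" using ce unfolding mem_tube by blast
    with tw sub show "L \<subseteq> L' \<and> (\<exists>h\<in>HH L'. p + h \<in> tube \<xi> K L \<epsilon> q)" by blast
  qed
qed

text \<open>Equal functions are arbitrarily close, so \<open>horo_near\<close> gives both inclusions
  of faces and puts a representative of the coset of \<open>p'\<close> into every tube about
  \<open>p\<close>. Functionals in \<open>L\<close> agree at the cone vector and at
  \<open>h\<close>; their difference at \<open>p' - p\<close> is due to \<open>b\<close> alone and
  vanishes in the limit.\<close>

lemma horo_eqD:
  assumes "L \<in> faces" "L' \<in> faces" "horo \<xi> L p = horo \<xi> L' p'"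
  shows "L = L'" "p' - p \<in> HH L"
proof -
  have near: "L \<subseteq> L' \<and> (\<exists>h\<in>HH L'. p' + h \<in> tube \<xi> K L \<epsilon> p)"
    if A: "L \<in> faces" "L' \<in> faces" "horo \<xi> L p = horo \<xi> L' p'" "\<epsilon> > 0" for L L' p p' \<epsilon>
  proof -
    obtain S e where e: "e > 0" and near: "\<forall>L'\<in>faces. \<forall>p'. (\<forall>x\<in>S. \<bar>horo \<xi> L' p' x - horo \<xi> L p x\<bar> < e) \<longrightarrow>
        L \<subseteq> L' \<and> (\<exists>h\<in>HH L'. p' + h \<in> tube \<xi> K L \<epsilon> p)"
      using horo_near[OF A(1,4), of p] by auto
    have "\<forall>x\<in>S. \<bar>horo \<xi> L' p' x - horo \<xi> L p x\<bar> < e" using A(3) e by simp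
    with near A(2) show ?thesis by blast
  qed
  show eq: "L = L'" using near[OF assms zero_less_one] near[OF assms(2,1) assms(3)[symmetric] zero_less_one] by auto
  note LK = faceD(1,2)[OF assms(1)]
  obtain C where C: "C > 0" "\<And>k u. k \<in> K \<Longrightarrow> \<bar>\<xi> k u\<bar> \<le> C * norm u" using xi_bound by blast
  have "\<xi> k (p' - p) = \<xi> l (p' - p)" if kl: "k \<in> L" "l \<in> L" for k l
  proof -
    have K: "k \<in> K" "l \<in> K" using kl LK by auto
    have "\<bar>\<xi> k (p' - p) - \<xi> l (p' - p)\<bar> \<le> \<epsilon>" if "\<epsilon> > 0" for \<epsilon>
    proof -
      have "\<epsilon> / (2 * C) > 0" using that C by simp
      from near[OF assms this] obtain h where
        h: "h \<in> HH L'" "p' + h \<in> tube \<xi> K L (\<epsilon> / (2 * C)) p" by blast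
      then obtain b u where bu: "norm b < \<epsilon> / (2 * C)" "u \<in> HP L" "p' + h = p + b + u"
        unfolding mem_tube by blast
      have "\<xi> k h = \<xi> l h" "\<xi> k u = \<xi> l u"
        using h bu kl eq unfolding Hplus_def H_def by blast+
      moreover have "p' - p = b + u - h" using bu(3) by (simp add: algebra_simps)
      ultimately have "\<xi> k (p' - p) - \<xi> l (p' - p) = \<xi> k b - \<xi> l b"
        using K by (simp only: xi_simps)
      moreover have "C * norm b \<le> \<epsilon> / 2" using bu(1) C by (simp add: field_simps)
      ultimately show ?thesis using C(2)[OF K(1), of b] C(2)[OF K(2), of b] by linarith
    qed
    from field_le_epsilon[of "\<bar>\<xi> k (p' - p) - \<xi> l (p' - p)\<bar>" 0] this show ?thesis by auto
  qed
  then show "p' - p \<in> HH L" unfolding H_def by blast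
qed

section \<open>Approximation by tubes, limits, and the closure\<close>

text \<open>A long shift along \<open>HP L\<close> makes the functionals of \<open>L\<close>
  dominate on bounded sets, so \<open>N L'\<close> may be replaced by \<open>N L\<close>. To
  \<open>horo \<xi> L\<close> the shift is invisible by \<open>horo_shift\<close>, and the ball part
  costs at most \<open>2 * C * \<epsilon> < e\<close>.\<close>

lemma tube_near:
  assumes L: "L \<in> faces" and "bounded S" "e > 0"
  shows "\<exists>\<epsilon>>0. \<exists>w\<in>HP L. \<forall>L'\<in>faces. L \<subseteq> L' \<longrightarrow> (\<forall>p'\<in>tube \<xi> K L \<epsilon> (p + w). \<forall>x\<in>S.
      \<bar>horo \<xi> L' p' x - horo \<xi> L p x\<bar> < e)"
proof -
  note LK = faceD(1,2)[OF L]
  obtain C where C: "C > 0" "\<And>k u. k \<in> K \<Longrightarrow> \<bar>\<xi> k u\<bar> \<le> C * norm u" using xi_bound by blast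
  obtain R where R: "R > 0" "\<And>x. x \<in> S \<Longrightarrow> norm x \<le> R" using \<open>bounded S\<close> bounded_pos by blast
  obtain w where w: "w \<in> HP L" using faceD(3)[OF L] by blast
  obtain d where d: "d > 0" "\<And>l k. l \<in> L \<Longrightarrow> k \<in> K - L \<Longrightarrow> d \<le> \<xi> l w - \<xi> k w"
    using Hplus_gap[OF LK(1) w] by blast
  define \<epsilon> where "\<epsilon> = e / (4 * C)"
  have \<epsilon>: "\<epsilon> > 0" "2 * C * \<epsilon> < e" using C \<open>e > 0\<close> by (simp_all add: \<epsilon>_def field_simps)
  \<comment> \<open>\<open>t * d\<close> exceeds twice the bound for each functional at
    \<open>p + b - z\<close> with \<open>norm z \<le> R\<close>.\<close>
  define t where "t = (2 * C * (norm p + \<epsilon> + R) + 1) / d"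
  have "2 * C * (norm p + \<epsilon> + R) \<ge> 0" using C \<epsilon> R by simp
  then have t: "t > 0" "t * d = 2 * C * (norm p + \<epsilon> + R) + 1"
    using d by (simp_all add: t_def)
  show ?thesis
  proof (intro exI[of _ \<epsilon>] conjI[of "\<epsilon> > 0"] bexI[of _ "t *\<^sub>R w"] ballI impI)
    show "\<epsilon> > 0" by (rule \<epsilon>)
    show tw: "t *\<^sub>R w \<in> HP L" using Hplus_scale[OF LK(1) w t(1)] .
    fix L' p' x assume L': "L' \<in> faces" "L \<subseteq> L'" and p': "p' \<in> tube \<xi> K L \<epsilon> (p + t *\<^sub>R w)"
      and x: "x \<in> S"
    obtain b u where bu: "norm b < \<epsilon>" "u \<in> HP L" "p' = p + t *\<^sub>R w + b + u"
      using p' unfolding mem_tube by blast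
    \<comment> \<open>Needed for \<open>z = x\<close> and \<open>z = 0\<close>, the two terms of
      \<open>horo\<close>.\<close>
    have restrict: "N L' (p' - z) = N L (p' - z)" if z: "norm z \<le> R" for z
    proof (rule nu_restrict[OF L'(2) faceD(1)[OF L'(1)] LK(2)])
      fix l j assume lj: "l \<in> L" "j \<in> L' - L"
      then have K: "l \<in> K" "j \<in> K" "j \<in> K - L" using LK faceD(1)[OF L'(1)] by auto
      have "norm (p + b - z) \<le> norm p + \<epsilon> + R"
        using norm_triangle_ineq4[of "p + b" z] norm_triangle_ineq[of p b] z bu by linarith
      then have "C * norm (p + b - z) \<le> C * (norm p + \<epsilon> + R)" using C by simp
      moreover have "\<bar>\<xi> l (p + b - z)\<bar> \<le> C * norm (p + b - z)"
        "\<bar>\<xi> j (p + b - z)\<bar> \<le> C * norm (p + b - z)" using C K by auto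
      moreover have "\<xi> l u > \<xi> j u" using bu(2) lj K unfolding Hplus_def by blast
      moreover have "t * d \<le> t * (\<xi> l w - \<xi> j w)"
        using d(2)[OF lj(1) K(3)] t by (intro mult_left_mono) auto
      moreover have "t * (\<xi> l w - \<xi> j w) = \<xi> l (t *\<^sub>R w) - \<xi> j (t *\<^sub>R w)"
        using K by (simp add: xi_simps algebra_simps)
      moreover have "\<xi> k (p' - z) = \<xi> k (p + b - z) + \<xi> k (t *\<^sub>R w) + \<xi> k u" if "k \<in> K" for k
        using that bu(3) by (simp add: xi_simps)
      ultimately show "\<xi> j (p' - z) \<le> \<xi> l (p' - z)" using K t(2) by auto
    qed
    have "p' = (p + b) + (t *\<^sub>R w + u)" using bu(3) by simp
    moreover have "t *\<^sub>R w + u \<in> HH L"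
      using tw bu(2) Hplus_subset[of L] by (intro H_closed(2) LK) blast+
    ultimately have "horo \<xi> L p' = horo \<xi> L (p + b)" using horo_shift[OF LK] by metis
    moreover have "horo \<xi> L' p' x = horo \<xi> L p' x"
      using restrict[OF R(2)[OF x]] restrict[of 0] R(1) by (simp add: horo_def)
    moreover have "2 * C * norm b \<le> 2 * C * \<epsilon>" using bu(1) C by simp
    ultimately show "\<bar>horo \<xi> L' p' x - horo \<xi> L p x\<bar> < e"
      using horo_lipschitz(2)[OF LK C(2), of p b x] \<epsilon>(2) by simp
  qed
qed

text \<open>Along a subsequence the differences \<open>\<xi> k (p n) - \<nu> (p n) \<le> 0\<close> converge in the extended
  reals; the indices with a finite limit form the face.\<close>

lemma horo_limit:
  assumes lim: "\<And>v. (\<lambda>n. horo \<xi> K (p n) v) \<longlonglongrightarrow> f v"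
  shows "\<exists>L\<in>faces. \<exists>q. f = horo \<xi> L q"
proof -
  obtain r A where r: "strict_mono r"
    and A: "\<And>k. k \<in> K \<Longrightarrow> (\<lambda>n. ereal (\<xi> k (p (r n)) - N K (p (r n)))) \<longlonglongrightarrow> A k"
    using ereal_finite_subseq[OF finite_K, of "\<lambda>k n. ereal (\<xi> k (p n) - N K (p n))"] by auto
  define a where "a k n = \<xi> k (p (r n)) - N K (p (r n))" for k n
  have a_le: "a k n \<le> 0" if "k \<in> K" for k n
    using nu_ge[OF subset_refl that] by (simp add: a_def)
  have A_le: "A k \<le> 0" if "k \<in> K" for k
    using A[OF that] a_le[OF that] unfolding a_def
    by (intro LIMSEQ_le_const2[OF A[OF that]]) (auto simp: zero_ereal_def)
  define L where "L = {k \<in> K. A k \<noteq> - \<infinity>}"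
  define \<alpha> where "\<alpha> k = real_of_ereal (A k)" for k
  have LK: "L \<subseteq> K" unfolding L_def by auto
  have a_lim: "a k \<longlonglongrightarrow> \<alpha> k" if "k \<in> L" for k
  proof -
    have "k \<in> K" "A k \<noteq> - \<infinity>" "A k \<noteq> \<infinity>" using that A_le[of k] unfolding L_def by auto
    then have "A k = ereal (\<alpha> k)" unfolding \<alpha>_def by (cases "A k") auto
    then show ?thesis using A[OF \<open>k \<in> K\<close>] unfolding a_def by simp
  qed
  have a_minf: "eventually (\<lambda>n. \<forall>k\<in>K - L. a k n < B) sequentially" for B
  proof (intro eventually_ball_finite ballI)
    show "finite (K - L)" using finite_K by simp
    fix k assume "k \<in> K - L"
    then have "(\<lambda>n. ereal (a k n)) \<longlonglongrightarrow> - \<infinity>" using A[of k] unfolding L_def a_def by auto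
    then show "eventually (\<lambda>n. a k n < B) sequentially" by (simp add: tendsto_MInfty)
  qed
  \<comment> \<open>For every \<open>n\<close> some \<open>k \<in> K\<close> has
    \<open>a k n = 0\<close>, so not all these sequences can tend to minus infinity.\<close>
  have "L \<noteq> {}"
  proof
    assume "L = {}"
    then obtain n where n: "\<forall>k\<in>K. a k n < 0"
      using eventually_happens'[OF sequentially_bot a_minf[of 0]] by auto
    obtain k where "k \<in> K" "N K (p (r n)) = \<xi> k (p (r n))"
      using nu_attained[OF subset_refl K_nonempty] by blast
    with n show False unfolding a_def by auto
  qed
  have "\<forall>k\<in>L. \<exists>M. \<forall>n. \<bar>a k n\<bar> \<le> M"
    using convergent_imp_Bseq[OF convergentI[OF a_lim]] unfolding Bseq_def by auto
  from bchoice[OF this] obtain m where m: "\<And>k n. k \<in> L \<Longrightarrow> \<bar>a k n\<bar> \<le> m k" by blast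
  define M where "M = sum m L"
  have M: "\<bar>a k n\<bar> \<le> M" if "k \<in> L" for k n
  proof -
    have "m k \<le> M" unfolding M_def using that finite_sub[OF LK] m
      by (intro member_le_sum) (auto intro: order_trans[OF abs_ge_zero])
    then show ?thesis using m[OF that, of n] by simp
  qed
  have M0: "M \<ge> 0" using M \<open>L \<noteq> {}\<close> abs_ge_zero order_trans by blast
  obtain C where C: "C > 0" "\<And>k u. k \<in> K \<Longrightarrow> \<bar>\<xi> k u\<bar> \<le> C * norm u" using xi_bound by blast
  obtain D where D: "D > 0" "\<And>u d. \<forall>k\<in>L. \<forall>l\<in>L. \<bar>\<xi> k u - \<xi> l u\<bar> \<le> d \<Longrightarrow> d \<ge> 0 \<Longrightarrow>
    \<exists>c. u - c \<in> HH L \<and> norm c \<le> D * d"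
    using H_distance[OF LK] by metis
  \<comment> \<open>The points \<open>p (r n)\<close> may be unbounded, but modulo
    \<open>HH L\<close> they have bounded representatives.\<close>
  have "\<exists>c. p (r n) - c \<in> HH L \<and> norm c \<le> D * (2 * M)" for n
  proof (intro D(2) ballI)
    fix k l assume kl: "k \<in> L" "l \<in> L"
    have "\<xi> k (p (r n)) - \<xi> l (p (r n)) = a k n - a l n" by (simp add: a_def)
    then show "\<bar>\<xi> k (p (r n)) - \<xi> l (p (r n))\<bar> \<le> 2 * M" using M[OF kl(1), of n] M[OF kl(2), of n] by linarith
  qed (use M0 in simp)
  then obtain c where c: "\<And>n. p (r n) - c n \<in> HH L" "\<And>n. norm (c n) \<le> D * (2 * M)" by metis
  \<comment> \<open>At this \<open>n\<close> the gap \<open>a l n - a k n\<close> exceeds the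
    possible contribution of \<open>c n\<close>; a single term of the sequence thus shows that
    \<open>HP L\<close> is nonempty.\<close>
  obtain n where n: "\<forall>k\<in>K - L. a k n < - (M + 2 * (C * (D * (2 * M))))"
    using eventually_happens'[OF sequentially_bot a_minf] by blast
  have "\<xi> l (p (r n) - c n) > \<xi> k (p (r n) - c n)" if lk: "l \<in> L" "k \<in> K - L" for l k
  proof -
    have K: "l \<in> K" "k \<in> K" using lk LK by auto
    have "\<xi> l (p (r n) - c n) - \<xi> k (p (r n) - c n) = (a l n - a k n) - (\<xi> l (c n) - \<xi> k (c n))"
      using K by (simp add: a_def xi_simps)
    moreover have "\<bar>\<xi> l (c n)\<bar> \<le> C * norm (c n)" "\<bar>\<xi> k (c n)\<bar> \<le> C * norm (c n)" using C K by auto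
    moreover have "C * norm (c n) \<le> C * (D * (2 * M))" using c(2) C by simp
    moreover have "a k n < - (M + 2 * (C * (D * (2 * M))))" using n lk by blast
    ultimately show ?thesis using M[OF lk(1), of n] by linarith
  qed
  then have "p (r n) - c n \<in> HP L" using c(1) unfolding Hplus_def by blast
  then have L: "L \<in> faces" using LK \<open>L \<noteq> {}\<close> unfolding faces_iff by blast
  have "bounded (range c)" using c(2) unfolding bounded_iff by auto
  then obtain q r' where r': "strict_mono r'" "(c \<circ> r') \<longlonglongrightarrow> q"
    using bounded_imp_convergent_subsequence by blast
  have q: "\<xi> k q - \<xi> l q = \<alpha> k - \<alpha> l" if kl: "k \<in> L" "l \<in> L" for k l
  proof (rule LIMSEQ_unique)
    have K: "k \<in> K" "l \<in> K" using kl LK by auto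
    have lin: "(\<lambda>n. \<xi> j ((c \<circ> r') n)) \<longlonglongrightarrow> \<xi> j q" if "j \<in> K" for j
      using bounded_linear.tendsto[OF _ r'(2)] linear_xi[OF that]
      by (auto simp: linear_conv_bounded_linear)
    show "(\<lambda>n. \<xi> k ((c \<circ> r') n) - \<xi> l ((c \<circ> r') n)) \<longlonglongrightarrow> \<xi> k q - \<xi> l q"
      using K by (intro tendsto_diff lin)
    have eq: "\<xi> k (c n) - \<xi> l (c n) = a k n - a l n" for n
    proof -
      have "\<xi> k (p (r n) - c n) = \<xi> l (p (r n) - c n)" using c(1)[of n] kl unfolding H_def by blast
      then show ?thesis using K by (simp add: a_def xi_simps)
    qed
    have "(\<lambda>n. a k (r' n)) \<longlonglongrightarrow> \<alpha> k" "(\<lambda>n. a l (r' n)) \<longlonglongrightarrow> \<alpha> l"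
      using LIMSEQ_subseq_LIMSEQ[OF a_lim r'(1)] kl by (auto simp: o_def)
    then show "(\<lambda>n. \<xi> k ((c \<circ> r') n) - \<xi> l ((c \<circ> r') n)) \<longlonglongrightarrow> \<alpha> k - \<alpha> l"
      unfolding o_def eq by (rule tendsto_diff)
  qed
  obtain l0 where l0: "l0 \<in> L" using \<open>L \<noteq> {}\<close> by blast
  \<comment> \<open>Only differences of the \<open>\<alpha> k\<close> are determined by
    \<open>q\<close>. The common offset \<open>g\<close> turns out to be \<open>- N L q\<close>,
    because \<open>f 0 = 0\<close>.\<close>
  define g where "g = \<alpha> l0 - \<xi> l0 q"
  have g: "\<alpha> k = \<xi> k q + g" if "k \<in> L" for k using q[OF that l0] by (simp add: g_def)
  have horo_a: "horo \<xi> K (p (r n)) v \<ge> a k n - \<xi> k v" if "k \<in> K" for k n v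
    using nu_ge[OF subset_refl that, of "p (r n) - v"] that by (simp add: horo_def a_def xi_simps)
  have horo_a': "\<exists>k\<in>K. horo \<xi> K (p (r n)) v = a k n - \<xi> k v" for n v
    using nu_attained[OF subset_refl K_nonempty, of "p (r n) - v"]
    by (auto simp: horo_def a_def xi_simps)
  have lim_r: "(\<lambda>n. horo \<xi> K (p (r n)) v) \<longlonglongrightarrow> f v" for v
    using LIMSEQ_subseq_LIMSEQ[OF lim r] by (simp add: o_def)
  \<comment> \<open>The lower bound uses one index attaining the maximum at \<open>q - v\<close>.
    For the upper bound, indices outside \<open>L\<close> eventually contribute less than
    \<open>?y\<close>.\<close>
  have f: "f v = N L (q - v) + g" for v
  proof (rule antisym)
    obtain k where k: "k \<in> L" "N L (q - v) = \<xi> k (q - v)" using nu_attained[OF LK \<open>L \<noteq> {}\<close>] by blast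
    have kK: "k \<in> K" using k LK by auto
    have "\<alpha> k - \<xi> k v \<le> f v"
      by (rule LIMSEQ_le[OF tendsto_diff[OF a_lim[OF k(1)] tendsto_const] lim_r])
        (use horo_a[OF kK] in blast)
    then show "N L (q - v) + g \<le> f v" using k g[OF k(1)] kK by (simp add: xi_simps)
    show "f v \<le> N L (q - v) + g"
    proof (rule field_le_epsilon)
      fix e :: real assume e: "e > 0"
      let ?y = "N L (q - v) + g + e"
      have "eventually (\<lambda>n. \<forall>k\<in>L. a k n - \<xi> k v < ?y) sequentially"
      proof (intro eventually_ball_finite ballI)
        show "finite L" using finite_sub[OF LK] .
        fix k assume k: "k \<in> L"
        then have kK: "k \<in> K" using LK by auto
        have "\<alpha> k - \<xi> k v < ?y"
          using nu_ge[OF LK k, of "q - v"] g[OF k] kK e by (simp add: xi_simps)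
        then show "eventually (\<lambda>n. a k n - \<xi> k v < ?y) sequentially"
          by (rule order_tendstoD(2)[OF tendsto_diff[OF a_lim[OF k] tendsto_const]])
      qed
      moreover have "eventually (\<lambda>n. \<forall>k\<in>K - L. a k n < ?y - C * norm v) sequentially"
        by (rule a_minf)
      ultimately have "eventually (\<lambda>n. horo \<xi> K (p (r n)) v \<le> ?y) sequentially"
      proof eventually_elim
        case (elim n)
        obtain k where k: "k \<in> K" "horo \<xi> K (p (r n)) v = a k n - \<xi> k v" using horo_a' by blast
        show ?case
        proof (cases "k \<in> L")
          case True
          then show ?thesis using elim(1) k(2) by auto
        next
          case False
          then have "a k n < ?y - C * norm v" using elim(2) k(1) by blast
          then show ?thesis using C(2)[OF k(1), of v] k(2) by linarith
        qed
      qed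
      then show "f v \<le> ?y" by (rule tendsto_upperbound[OF lim_r]) simp
    qed
  qed
  have "(\<lambda>n. horo \<xi> K (p n) 0) = (\<lambda>n. 0)" by (simp add: horo_def)
  then have "f 0 = 0" using lim[of 0] by (simp add: LIMSEQ_const_iff)
  then have "f = horo \<xi> L q" using f[of 0] by (auto simp: horo_def f)
  with L show ?thesis by blast
qed

definition horos where "horos = {horo \<xi> L p | L p. L \<in> faces}"

lemma horos_subset: "horos \<subseteq> pointed_continuous"
  unfolding horos_def using horo_pointed_continuous by blast

text \<open>A function in the closure is approximated on the balls of radius \<open>n\<close>, and
  \<open>horo_limit\<close> identifies the pointwise limit. Conversely, \<open>tube_near\<close>
  with \<open>L' = K\<close> supplies nearby functions from the open stratum.\<close>

lemma closure_horo:
  "bounded_uniform_topology closure_of {\<lambda>u. delta \<xi> K p u - delta \<xi> K p 0 | p. True} = horos"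
proof -
  have delta: "(\<lambda>u. delta \<xi> K p u - delta \<xi> K p 0) = horo \<xi> K p" for p
    by (simp add: fun_eq_iff delta_def horo_def)
  show ?thesis
    unfolding delta
  proof (intro set_eqI iffI)
    fix f assume f: "f \<in> bounded_uniform_topology closure_of {horo \<xi> K p | p. True}"
    have pc: "f \<in> pointed_continuous"
      using f unfolding in_closure_of topspace_bounded_uniform_topology by blast
    have "\<exists>p. \<forall>v\<in>cball 0 (real n). \<bar>horo \<xi> K p v - f v\<bar> < 1 / (real n + 1)" for n
    proof -
      obtain W where W: "openin bounded_uniform_topology W" "f \<in> W"
        "\<forall>g\<in>W. \<forall>v\<in>cball 0 (real n). \<bar>g v - f v\<bar> < 1 / (real n + 1)"
        using bounded_uniform_nbhd[OF pc bounded_cball, of "1 / (real n + 1)" 0 "real n"] by auto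
      then obtain g where "g \<in> {horo \<xi> K p | p. True}" "g \<in> W"
        using f unfolding in_closure_of by blast
      then show ?thesis using W(3) by blast
    qed
    then obtain p where p: "\<And>n v. norm v \<le> real n \<Longrightarrow> \<bar>horo \<xi> K (p n) v - f v\<bar> < 1 / (real n + 1)"
      by (metis mem_cball_0)
    have "(\<lambda>n. horo \<xi> K (p n) v) \<longlonglongrightarrow> f v" for v
    proof (rule Lim_transform_bound[THEN LIM_zero_cancel])
      obtain n0 where n0: "norm v \<le> real n0" using real_arch_simple by blast
      show "eventually (\<lambda>n. norm (horo \<xi> K (p n) v - f v) \<le> norm (1 / (real n + 1))) sequentially"
        using eventually_ge_at_top[of n0]
      proof eventually_elim
        case (elim n)
        then have "norm v \<le> real n" using n0 by linarith
        then show ?case using p[of v n] by simp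
      qed
      show "(\<lambda>n. 1 / (real n + 1)) \<longlonglongrightarrow> 0"
        using LIMSEQ_inverse_real_of_nat by (simp add: inverse_eq_divide add.commute)
    qed
    then show "f \<in> horos" using horo_limit[of p f] unfolding horos_def by blast
  next
    fix f assume "f \<in> horos"
    then obtain L p where L: "L \<in> faces" and f: "f = horo \<xi> L p" unfolding horos_def by blast
    show "f \<in> bounded_uniform_topology closure_of {horo \<xi> K p | p. True}"
      unfolding in_closure_of topspace_bounded_uniform_topology
    proof (intro conjI allI impI)
      show pc: "f \<in> pointed_continuous" using L f horo_pointed_continuous by blast
      fix W assume W: "f \<in> W \<and> openin bounded_uniform_topology W"
      then obtain S e where S: "bounded S" "e > 0"
        "{g \<in> pointed_continuous. \<forall>x\<in>S. \<bar>g x - f x\<bar> < e} \<subseteq> W"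
        unfolding openin_bounded_uniform_topology by auto
      obtain \<epsilon> w where w: "\<epsilon> > 0" "w \<in> HP L" "\<forall>L'\<in>faces. L \<subseteq> L' \<longrightarrow> (\<forall>p'\<in>tube \<xi> K L \<epsilon> (p + w).
          \<forall>x\<in>S. \<bar>horo \<xi> L' p' x - horo \<xi> L p x\<bar> < e)"
        using tube_near[OF L S(1,2), of p] by blast
      \<comment> \<open>The second \<open>w\<close> is the cone component, with
        \<open>b = 0\<close>.\<close>
      have "p + w + w \<in> tube \<xi> K L \<epsilon> (p + w)"
        unfolding mem_tube using w by (intro exI[of _ 0] exI[of _ w]) simp
      then have "\<forall>x\<in>S. \<bar>horo \<xi> K (p + w + w) x - f x\<bar> < e"
        using w(3) faceD(1)[OF L] f by blast
      then have "horo \<xi> K (p + w + w) \<in> W" using S(3) horo_pointed_continuous[of K] by auto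
      then show "\<exists>g. g \<in> {horo \<xi> K p |p. True} \<and> g \<in> W" by blast
    qed
  qed
qed

section \<open>The bordification and its bijection onto the strata\<close>

lemma topspace_bordification: "topspace (bordification \<xi> K) = horos"
  unfolding bordification_def closure_horo
  using horos_subset by (auto simp: topspace_bounded_uniform_topology)

lemma openin_bordification:
  "openin (bordification \<xi> K) V \<longleftrightarrow> V \<subseteq> horos \<and>
    (\<forall>f\<in>V. \<exists>S e. bounded S \<and> e > 0 \<and> {g \<in> horos. \<forall>x\<in>S. \<bar>g x - f x\<bar> < e} \<subseteq> V)"
  unfolding bordification_def closure_horo
  by (rule openin_subtopology_bounded_uniform[OF horos_subset])

lemma coset_eq_iff:
  assumes "L \<subseteq> K"
  shows "p +o HH L = p' +o HH L \<longleftrightarrow> p' - p \<in> HH L"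
proof
  assume "p +o HH L = p' +o HH L"
  moreover have "p' + 0 \<in> p' +o HH L" using H_closed(1)[OF assms] by (rule set_plus_intro2)
  ultimately have "p' \<in> p +o HH L" by simp
  then show "p' - p \<in> HH L" by (auto simp: elt_set_plus_def)
next
  assume h: "p' - p \<in> HH L"
  show "p +o HH L = p' +o HH L"
  proof (intro set_eqI iffI)
    fix x assume "x \<in> p +o HH L"
    then obtain u where "u \<in> HH L" "x = p + u" by (auto simp: elt_set_plus_def)
    then have "u - (p' - p) \<in> HH L" "x = p' + (u - (p' - p))"
      using H_closed(3)[OF assms _ h] by auto
    then show "x \<in> p' +o HH L" unfolding elt_set_plus_def by blast
  next
    fix x assume "x \<in> p' +o HH L"
    then obtain u where "u \<in> HH L" "x = p' + u" by (auto simp: elt_set_plus_def)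
    then have "u + (p' - p) \<in> HH L" "x = p + (u + (p' - p))"
      using H_closed(2)[OF assms _ h] by auto
    then show "x \<in> p +o HH L" unfolding elt_set_plus_def by blast
  qed
qed

lemma point_eq_iff:
  assumes "L \<in> faces" "L' \<in> faces"
  shows "point \<xi> K L p = point \<xi> K L' p' \<longleftrightarrow> L = L' \<and> p' - p \<in> HH L"
proof (cases "L = K \<or> L' = K")
  case True
  then show ?thesis using H_K by (auto simp: point_def)
next
  case False
  then show ?thesis using coset_eq_iff[OF faceD(1)[OF assms(1)]] by (auto simp: point_def)
qed

text \<open>One direction makes the function of a stratum point well defined, the other is the
  injectivity of \<open>Phi\<close>.\<close>

lemma horo_eq_iff_point_eq:
  assumes "L \<in> faces" "L' \<in> faces"
  shows "horo \<xi> L p = horo \<xi> L' p' \<longleftrightarrow> point \<xi> K L p = point \<xi> K L' p'"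
proof
  assume "horo \<xi> L p = horo \<xi> L' p'"
  then show "point \<xi> K L p = point \<xi> K L' p'"
    using horo_eqD[OF assms] unfolding point_eq_iff[OF assms] by blast
next
  assume "point \<xi> K L p = point \<xi> K L' p'"
  then have "L = L'" "p' - p \<in> HH L" using point_eq_iff[OF assms] by auto
  then show "horo \<xi> L p = horo \<xi> L' p'"
    using horo_shift[OF faceD(1,2)[OF assms(1)], of "p' - p" p] by simp
qed

text \<open>The definite description is legitimate: all representations of the same function name
  the same point, by \<open>horo_eq_iff_point_eq\<close>.\<close>

lemma Phi_horo:
  assumes L: "L \<in> faces"
  shows "Phi \<xi> K (horo \<xi> L p) = point \<xi> K L p"
proof -
  let ?Q = "\<lambda>y. (\<exists>p'. horo \<xi> L p = (\<lambda>v. nu \<xi> K (p' - v) - nu \<xi> K p') \<and> y = Inl p') \<or>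
     (\<exists>L'\<in>dual_faces \<xi> K. \<exists>p'. horo \<xi> L p = (\<lambda>v. nu \<xi> L' (p' - v) - nu \<xi> L' p') \<and> y = Inr (L', p' +o HH L'))"
  have "?Q y \<longleftrightarrow> (\<exists>L'\<in>faces. \<exists>p'. horo \<xi> L p = horo \<xi> L' p' \<and> y = point \<xi> K L' p')" for y
    using K_notin_dual_faces by (auto simp: horo_def[abs_def] point_def)
  moreover have "(\<exists>L'\<in>faces. \<exists>p'. horo \<xi> L p = horo \<xi> L' p' \<and> y = point \<xi> K L' p') \<longleftrightarrow>
    y = point \<xi> K L p" for y
  proof
    assume "\<exists>L'\<in>faces. \<exists>p'. horo \<xi> L p = horo \<xi> L' p' \<and> y = point \<xi> K L' p'"
    then obtain L' p' where L': "L' \<in> faces" "horo \<xi> L p = horo \<xi> L' p'" "y = point \<xi> K L' p'"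
      by blast
    then show "y = point \<xi> K L p" using horo_eq_iff_point_eq[OF L L'(1)] by simp
  next
    assume "y = point \<xi> K L p"
    then show "\<exists>L'\<in>faces. \<exists>p'. horo \<xi> L p = horo \<xi> L' p' \<and> y = point \<xi> K L' p'"
      using L by (intro bexI[of _ L] exI[of _ p]) simp
  qed
  ultimately have "?Q = (\<lambda>y. y = point \<xi> K L p)" by (simp only:)
  then show ?thesis unfolding Phi_def by simp
qed

lemma strata_eq: "strata \<xi> K = {point \<xi> K L p | L p. L \<in> faces}"
  using K_notin_dual_faces unfolding strata_def point_def by (auto simp: image_iff) 

text \<open>Enlarging \<open>D\<close> by \<open>HH L'\<close> produces no new cosets of
  \<open>HH L'\<close>. The open part of \<open>U_set\<close> is the term \<open>L' = K\<close>,
  which is the only term if \<open>L = K\<close>.\<close>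

lemma U_set_eq:
  assumes L: "L \<in> faces"
  shows "U_set \<xi> K L \<epsilon> q = {point \<xi> K L' p | L' p. L' \<in> faces \<and> L \<subseteq> L' \<and> p \<in> tube \<xi> K L \<epsilon> q}"
proof (cases "L = K")
  case True
  have "L' = K" if "L' \<in> faces" "K \<subseteq> L'" for L' using faceD(1)[OF that(1)] that by blast
  moreover have "tube \<xi> K K \<epsilon> q = q +o ball 0 \<epsilon>"
    by (auto simp: mem_tube Hplus_K elt_set_plus_def)
  ultimately show ?thesis using True by (auto simp: U_set_def point_def)
next
  case False
  let ?D = "tube \<xi> K L \<epsilon> q"
  have coset: "{p +o HH L' | p. p \<in> ?D + HH L'} = {p +o HH L' | p. p \<in> ?D}" if "L' \<in> faces" for L'
  proof -
    note LK = faceD(1)[OF that]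
    have "(d + h) +o HH L' = d +o HH L'" if "h \<in> HH L'" for d h
      using coset_eq_iff[OF LK, of "d + h" d] H_closed(5)[OF LK that] by simp
    moreover have "d \<in> ?D + HH L'" if "d \<in> ?D" for d
      using set_plus_intro[OF that H_closed(1)[OF LK]] by simp
    ultimately show ?thesis by (auto elim!: set_plus_elim)
  qed
  have "U_set \<xi> K L \<epsilon> q = Inl ` ?D \<union>
      Inr ` (SIGMA L' : {L' \<in> dual_faces \<xi> K. L \<subseteq> L'}. {p +o HH L' | p. p \<in> ?D + HH L'})"
    using False unfolding U_set_def tube_def by (simp add: Let_def)
  also have "\<dots> = Inl ` ?D \<union>
      Inr ` (SIGMA L' : {L' \<in> dual_faces \<xi> K. L \<subseteq> L'}. {p +o HH L' | p. p \<in> ?D})"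
    using coset by (intro arg_cong2[where f = "(\<union>)"] arg_cong2[where f = image] Sigma_cong refl) auto
  also have "\<dots> = {point \<xi> K L' p | L' p. L' \<in> faces \<and> L \<subseteq> L' \<and> p \<in> ?D}"
    using K_notin_dual_faces faceD(1)[OF L] unfolding point_def by (auto simp: image_iff)
  finally show ?thesis .
qed

text \<open>At \<open>p\<close> the ball has the slack \<open>\<epsilon> - norm b\<close>, and
  \<open>Hplus_add\<close> absorbs the cone of \<open>L'\<close>. Openness of \<open>U_set\<close>
  at any of its points is thereby reduced to \<open>horo_near\<close> centred at that point.\<close>

lemma tube_subset:
  assumes "L \<subseteq> L'" "L' \<subseteq> K" "p \<in> tube \<xi> K L \<epsilon> q"
  shows "\<exists>\<epsilon>'>0. tube \<xi> K L' \<epsilon>' p \<subseteq> tube \<xi> K L \<epsilon> q"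
proof -
  obtain b u where b: "norm b < \<epsilon>" "u \<in> HP L" "p = q + b + u"
    using assms(3) unfolding mem_tube by blast
  have "x \<in> tube \<xi> K L \<epsilon> q" if x: "x \<in> tube \<xi> K L' (\<epsilon> - norm b) p" for x
  proof -
    obtain b' u' where b': "norm b' < \<epsilon> - norm b" "u' \<in> HP L'" "x = p + b' + u'"
      using x unfolding mem_tube by blast
    have "norm (b + b') < \<epsilon>" using b' norm_triangle_ineq[of b b'] by linarith
    moreover have "u' + u \<in> HP L" using Hplus_add[OF assms(1,2) b'(2) b(2)] .
    moreover have "x = q + (b + b') + (u' + u)" using b b' by simp
    ultimately show ?thesis unfolding mem_tube by blast
  qed
  then show ?thesis using b(1) by (intro exI[of _ "\<epsilon> - norm b"]) auto
qed

lemma strata_topology: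
  "topspace (strata_topology \<xi> K) = strata \<xi> K \<and>
    homeomorphic_map (bordification \<xi> K) (strata_topology \<xi> K) (Phi \<xi> K)"
  unfolding strata_topology_def
proof (rule theI', rule ex1_homeomorphic_topology)
  show "inj_on (Phi \<xi> K) (topspace (bordification \<xi> K))"
    unfolding topspace_bordification horos_def
  proof (intro inj_onI)
    fix f g assume "f \<in> {horo \<xi> L p | L p. L \<in> faces}" "g \<in> {horo \<xi> L p | L p. L \<in> faces}"
      and eq: "Phi \<xi> K f = Phi \<xi> K g"
    then obtain L p L' p' where f: "L \<in> faces" "f = horo \<xi> L p"
      and g: "L' \<in> faces" "g = horo \<xi> L' p'" by blast
    show "f = g" using eq unfolding f g Phi_horo[OF f(1)] Phi_horo[OF g(1)]
      by (simp only: horo_eq_iff_point_eq[OF f(1) g(1)])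
  qed
  show "Phi \<xi> K ` topspace (bordification \<xi> K) = strata \<xi> K"
  proof (intro set_eqI iffI)
    fix y assume "y \<in> Phi \<xi> K ` topspace (bordification \<xi> K)"
    then obtain L p where "L \<in> faces" "y = Phi \<xi> K (horo \<xi> L p)"
      unfolding topspace_bordification horos_def by blast
    then show "y \<in> strata \<xi> K" using Phi_horo unfolding strata_eq by blast
  next
    fix y assume "y \<in> strata \<xi> K"
    then obtain L p where L: "L \<in> faces" "y = point \<xi> K L p" unfolding strata_eq by blast
    then have "y = Phi \<xi> K (horo \<xi> L p)" by (simp only: Phi_horo)
    then show "y \<in> Phi \<xi> K ` topspace (bordification \<xi> K)"
      using L(1) unfolding topspace_bordification horos_def by blast
  qed
qed

section \<open>Openness in the parameters, and the basis\<close>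

text \<open>Translates openness into the parameters \<open>L\<close> and \<open>p\<close>, the form
  in which \<open>horo_near\<close> and \<open>tube_near\<close> apply.\<close>

lemma openin_strata_topology:
  "openin (strata_topology \<xi> K) W \<longleftrightarrow> W \<subseteq> strata \<xi> K \<and>
    (\<forall>L\<in>faces. \<forall>p. point \<xi> K L p \<in> W \<longrightarrow> (\<exists>S e. bounded S \<and> e > 0 \<and>
      (\<forall>L'\<in>faces. \<forall>p'. (\<forall>x\<in>S. \<bar>horo \<xi> L' p' x - horo \<xi> L p x\<bar> < e) \<longrightarrow> point \<xi> K L' p' \<in> W)))"
proof -
  let ?V = "{f \<in> horos. Phi \<xi> K f \<in> W}"
  have mem: "horo \<xi> L p \<in> ?V \<longleftrightarrow> point \<xi> K L p \<in> W" if "L \<in> faces" for L p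
  proof -
    have "horo \<xi> L p \<in> horos" using that unfolding horos_def by blast
    then show ?thesis by (simp only: mem_Collect_eq Phi_horo[OF that] simp_thms)
  qed
  have ball: "(\<forall>f\<in>horos. P f) \<longleftrightarrow> (\<forall>L\<in>faces. \<forall>p. P (horo \<xi> L p))" for P
    unfolding horos_def by blast
  have sub: "{g \<in> horos. \<forall>x\<in>S. \<bar>g x - f x\<bar> < e} \<subseteq> ?V \<longleftrightarrow>
    (\<forall>L'\<in>faces. \<forall>p'. (\<forall>x\<in>S. \<bar>horo \<xi> L' p' x - f x\<bar> < e) \<longrightarrow> point \<xi> K L' p' \<in> W)" for S f e
  proof -
    have "{g \<in> horos. \<forall>x\<in>S. \<bar>g x - f x\<bar> < e} \<subseteq> ?V \<longleftrightarrow>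
        (\<forall>g\<in>horos. (\<forall>x\<in>S. \<bar>g x - f x\<bar> < e) \<longrightarrow> g \<in> ?V)" by blast
    then show ?thesis unfolding ball using mem by blast
  qed
  have "openin (strata_topology \<xi> K) W \<longleftrightarrow> W \<subseteq> strata \<xi> K \<and>
    (\<forall>f\<in>horos. f \<in> ?V \<longrightarrow>
      (\<exists>S e. bounded S \<and> e > 0 \<and> {g \<in> horos. \<forall>x\<in>S. \<bar>g x - f x\<bar> < e} \<subseteq> ?V))"
    unfolding openin_homeomorphic_image[OF conjunct2[OF strata_topology]]
      conjunct1[OF strata_topology] topspace_bordification openin_bordification by blast
  then show ?thesis unfolding sub unfolding ball using mem by auto
qed

text \<open>The sets are open by \<open>horo_near\<close>, and by \<open>tube_near\<close> every
  open set contains one of them around each of its points.\<close>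

lemma strata_basis:
  "openin (strata_topology \<xi> K) =
    arbitrary union_of (\<lambda>W. \<exists>L\<in>faces. \<exists>\<epsilon>>0. \<exists>q. W = U_set \<xi> K L \<epsilon> q)"
  unfolding openin_topology_base_unique
proof (intro conjI allI impI)
  fix W assume "\<exists>L\<in>faces. \<exists>\<epsilon>>0. \<exists>q. W = U_set \<xi> K L \<epsilon> q"
  then obtain L \<epsilon> q where L: "L \<in> faces" "\<epsilon> > 0" and W: "W = U_set \<xi> K L \<epsilon> q" by blast
  note W = W[unfolded U_set_eq[OF L(1)]]
  show "openin (strata_topology \<xi> K) W"
    unfolding openin_strata_topology
  proof (intro conjI ballI allI impI)
    show "W \<subseteq> strata \<xi> K" unfolding W strata_eq by blast
    fix M p assume M: "M \<in> faces" and "point \<xi> K M p \<in> W"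
    \<comment> \<open>The given representative \<open>p\<close> need not lie in the tube; it is
      exchanged for \<open>p1\<close>, which defines the same function.\<close>
    then obtain L1 p1 where p1: "L1 \<in> faces" "L \<subseteq> L1" "p1 \<in> tube \<xi> K L \<epsilon> q"
      "point \<xi> K M p = point \<xi> K L1 p1" unfolding W by blast
    then have eq: "horo \<xi> M p = horo \<xi> L1 p1" using horo_eq_iff_point_eq[OF M p1(1)] by blast
    obtain \<epsilon>' where \<epsilon>': "\<epsilon>' > 0" "tube \<xi> K L1 \<epsilon>' p1 \<subseteq> tube \<xi> K L \<epsilon> q"
      using tube_subset[OF p1(2) faceD(1)[OF p1(1)] p1(3)] by blast
    obtain S e where S: "bounded S" "e > 0"
      and near: "\<forall>L'\<in>faces. \<forall>p'. (\<forall>x\<in>S. \<bar>horo \<xi> L' p' x - horo \<xi> L1 p1 x\<bar> < e) \<longrightarrow>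
        L1 \<subseteq> L' \<and> (\<exists>h\<in>HH L'. p' + h \<in> tube \<xi> K L1 \<epsilon>' p1)"
      using horo_near[OF p1(1) \<epsilon>'(1), of p1] by auto
    have "point \<xi> K L' p' \<in> W"
      if L': "L' \<in> faces" and close: "\<forall>x\<in>S. \<bar>horo \<xi> L' p' x - horo \<xi> M p x\<bar> < e" for L' p'
    proof -
      obtain h where h: "L1 \<subseteq> L'" "h \<in> HH L'" "p' + h \<in> tube \<xi> K L1 \<epsilon>' p1"
        using near L' close unfolding eq by blast
      have "point \<xi> K L' p' = point \<xi> K L' (p' + h)" using h(2) by (simp only: point_eq_iff[OF L' L']) simp
      moreover have "L \<subseteq> L'" "p' + h \<in> tube \<xi> K L \<epsilon> q" using h p1(2) \<epsilon>'(2) by auto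
      ultimately show ?thesis unfolding W using L' by blast
    qed
    with S show "\<exists>S e. bounded S \<and> e > 0 \<and> (\<forall>L'\<in>faces. \<forall>p'.
        (\<forall>x\<in>S. \<bar>horo \<xi> L' p' x - horo \<xi> M p x\<bar> < e) \<longrightarrow> point \<xi> K L' p' \<in> W)"
      by (intro exI[of _ S] exI[of _ e]) blast
  qed
next
  fix W y assume "openin (strata_topology \<xi> K) W \<and> y \<in> W"
  then have W: "openin (strata_topology \<xi> K) W" "y \<in> W" by auto
  then have "y \<in> strata \<xi> K" unfolding openin_strata_topology by blast
  then obtain L p where L: "L \<in> faces" and y: "y = point \<xi> K L p" unfolding strata_eq by blast
  then obtain S e where S: "bounded S" "e > 0"
    and near: "\<forall>L'\<in>faces. \<forall>p'. (\<forall>x\<in>S. \<bar>horo \<xi> L' p' x - horo \<xi> L p x\<bar> < e) \<longrightarrow> point \<xi> K L' p' \<in> W"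
    using W unfolding openin_strata_topology by blast
  obtain \<epsilon> w where w: "\<epsilon> > 0" "w \<in> HP L" "\<forall>L'\<in>faces. L \<subseteq> L' \<longrightarrow> (\<forall>p'\<in>tube \<xi> K L \<epsilon> (p + w).
      \<forall>x\<in>S. \<bar>horo \<xi> L' p' x - horo \<xi> L p x\<bar> < e)"
    using tube_near[OF L S, of p] by blast
  have wH: "w \<in> HH L" using w(2) Hplus_subset by blast
  have "p + w + w \<in> tube \<xi> K L \<epsilon> (p + w)"
    unfolding mem_tube using w by (intro exI[of _ 0] exI[of _ w]) simp
  \<comment> \<open>Shifting by \<open>w + w\<close> stays within the coset, so the set with centre
    \<open>p + w\<close> still contains \<open>y\<close>.\<close>
  moreover have "y = point \<xi> K L (p + w + w)"
    using H_closed(2)[OF faceD(1)[OF L] wH wH] by (simp only: y point_eq_iff[OF L L]) simp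
  ultimately have "y \<in> U_set \<xi> K L \<epsilon> (p + w)" unfolding U_set_eq[OF L] using L by blast
  moreover have "U_set \<xi> K L \<epsilon> (p + w) \<subseteq> W" unfolding U_set_eq[OF L] using near w(3) by blast
  ultimately show "\<exists>V. (\<exists>L\<in>faces. \<exists>\<epsilon>>0. \<exists>q. V = U_set \<xi> K L \<epsilon> q) \<and> y \<in> V \<and> V \<subseteq> W"
    using L w(1) by blast
qed

end

section \<open>From the facets of the polyhedron to the functionals\<close>

text \<open>Every ray from 0 leaves the compact set \<open>B\<close> through a facet, whence
  \<open>positive\<close>. A relative interior point of a facet lies on no other facet, whence
  \<open>irredundant\<close>.\<close>

lemma polyhedral_norm_facets:
  fixes B :: "'a::euclidean_space set"
  assumes "compact B" and "convex B" and "polyhedron B" and int0: "0 \<in> interior B"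
    and fin: "finite K"
    and bij: "bij_betw A K {F. F facet_of B}"
    and lin: "\<And>j. j \<in> K \<Longrightarrow> linear (\<xi> j)"
    and A: "\<And>j. j \<in> K \<Longrightarrow> A j = {v \<in> B. \<xi> j v = 1}"
  shows "polyhedral_norm \<xi> K"
proof (rule polyhedral_norm.intro)
  show "finite K" by (rule fin)
  show "linear (\<xi> k)" if "k \<in> K" for k by (rule lin[OF that])
  have facet: "A k facet_of B" if "k \<in> K" for k using bij that by (auto simp: bij_betw_def)
  show "\<exists>k\<in>K. \<xi> k w > 0" if w: "w \<noteq> 0" for w
  proof -
    obtain d where d: "d > 0" "0 + d *\<^sub>R w \<in> frontier B"
      using ray_to_frontier[OF compact_imp_bounded[OF \<open>compact B\<close>] int0 w] by blast
    have "frontier B = B - rel_interior B"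
      using int0 compact_imp_closed[OF \<open>compact B\<close>]
      by (subst rel_interior_nonempty_interior) (auto simp: frontier_def)
    then have "d *\<^sub>R w \<in> \<Union>{F. F facet_of B}"
      using d(2) rel_boundary_of_polyhedron[OF \<open>polyhedron B\<close>] by simp
    then obtain k where k: "k \<in> K" "d *\<^sub>R w \<in> A k" using bij by (auto simp: bij_betw_def)
    then have "d * \<xi> k w = 1" using A[OF k(1)] linear_scale[OF lin[OF k(1)], of d w] by auto
    then have "\<xi> k w > 0" using d(1) by (metis zero_less_mult_pos zero_less_one)
    with k(1) show ?thesis by blast
  qed
  \<comment> \<open>Otherwise the segment from 0 to \<open>x\<close> would meet the face
    \<open>A j\<close> in an inner point, forcing 0 into \<open>A j\<close>, although
    \<open>\<xi> j\<close> vanishes at 0.\<close>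
  have le1: "\<xi> j x \<le> 1" if j: "j \<in> K" and x: "x \<in> B" for j x
  proof (rule ccontr)
    assume "\<not> \<xi> j x \<le> 1"
    then have gt: "\<xi> j x > 1" by simp
    define t where "t = 1 / \<xi> j x"
    have t: "0 < t" "t < 1" "t * \<xi> j x = 1" using gt by (auto simp: t_def)
    have x0: "x \<noteq> 0" using gt linear_0[OF lin[OF j]] by auto
    have B0: "0 \<in> B" using int0 interior_subset by blast
    have seg: "t *\<^sub>R x \<in> open_segment 0 x"
      using t x0 by (auto simp: in_segment intro!: exI[of _ t])
    have "t *\<^sub>R x \<in> B"
      using convexD_alt[OF \<open>convex B\<close> B0 x, of t] t by simp
    then have "t *\<^sub>R x \<in> A j" using A[OF j] t linear_scale[OF lin[OF j], of t x] by simp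
    then have "0 \<in> A j"
      using face_ofD[OF facet_of_imp_face_of[OF facet[OF j]] seg B0 x] by blast
    then show False using A[OF j] linear_0[OF lin[OF j]] by simp
  qed
  show "\<exists>v. \<xi> k v = 1 \<and> (\<forall>j\<in>K - {k}. \<xi> j v < 1)" if k: "k \<in> K" for k
  proof -
    have "A k \<noteq> {}" using facet[OF k] by (simp add: facet_of_def)
    moreover have "convex (A k)"
      using face_of_imp_convex[OF facet_of_imp_face_of[OF facet[OF k]]] by simp
    ultimately obtain v where v: "v \<in> rel_interior (A k)" using rel_interior_eq_empty by blast
    then have vA: "v \<in> A k" using rel_interior_subset by blast
    then have vB: "v \<in> B" "\<xi> k v = 1" using A[OF k] by auto
    \<comment> \<open>If \<open>v\<close> were on \<open>A j\<close>, this face would meet the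
      relative interior of \<open>A k\<close> and hence contain \<open>A k\<close>; equal dimensions
      give \<open>A k = A j\<close>, against injectivity of \<open>A\<close>.\<close>
    have "\<xi> j v < 1" if j: "j \<in> K" "j \<noteq> k" for j
    proof (rule ccontr)
      assume "\<not> \<xi> j v < 1"
      then have "v \<in> A j" using le1[OF j(1) vB(1)] vB(1) A[OF j(1)] by auto
      moreover have "A k \<subseteq> B" using A[OF k] by auto
      ultimately have sub: "A k \<subseteq> A j"
        using v by (intro subset_of_face_of[OF facet_of_imp_face_of[OF facet[OF j(1)]]]) auto
      have "A k face_of A j"
        using face_of_subset[OF facet_of_imp_face_of[OF facet[OF k]] sub] A[OF j(1)] by auto
      moreover have "aff_dim (A k) = aff_dim (A j)" using facet[OF k] facet[OF j(1)] by (simp add: facet_of_def)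
      moreover have "convex (A j)"
        using face_of_imp_convex[OF facet_of_imp_face_of[OF facet[OF j(1)]]] by simp
      ultimately have "A k = A j" using face_of_aff_dim_lt[of "A j" "A k"] by auto
      then show False using bij j k by (auto simp: bij_betw_def inj_on_def)
    qed
    with vB show ?thesis by auto
  qed
qed

theorem theorem6p24:
  fixes B :: "'a::euclidean_space set"
    and A :: "nat \<Rightarrow> 'a set"
    and \<xi> :: "nat \<Rightarrow> 'a \<Rightarrow> real"
    and m :: nat
    and K :: "nat set"
  assumes "compact B" and "convex B" and "polyhedron B" and "0 \<in> interior B"
    and "K = {0..m}"
    and "bij_betw A K {F. F facet_of B}"
    and "\<And>j. j \<in> K \<Longrightarrow> linear (\<xi> j)"
    and "\<And>j. j \<in> K \<Longrightarrow> A j = {v \<in> B. \<xi> j v = 1}"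
  shows "openin (strata_topology \<xi> K) =
    arbitrary union_of
      (\<lambda>W. \<exists>L \<in> dual_faces \<xi> K \<union> {K}. \<exists>\<epsilon>>0. \<exists>q. W = U_set \<xi> K L \<epsilon> q)"
proof -
  have "finite K" using assms(5) by simp
  then have "polyhedral_norm \<xi> K"
    using polyhedral_norm_facets[OF assms(1-4) _ assms(6-8)] by blast
  then show ?thesis by (rule polyhedral_norm.strata_basis)
qed

end
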